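(* Assume (A1)--(A5). Then there exists a nontrivial homoclinic orbit of the difference equation $$\Delta^2x(t-1)-L(t)x(t)+V'_x(t,x(t))=0,\qquad t\in\mathbb{Z},$$ that is, a solution $x:\mathbb{Z}\to\mathbb{R}^n$, $x\not\equiv0$, with $x(t)\to0$ as $|t|\to\infty$.
   Context: Fix $n\ge 1$; $\langle\cdot,\cdot\rangle$, $|\cdot|$ are the Euclidean inner product and norm on $\mathbb{R}^n$; $\Delta x(t-1)=x(t)-x(t-1)$, $\Delta^2x(t-1)=\Delta(\Delta x(t-1))=x(t+1)-2x(t)+x(t-1)$. For each $t\in\mathbb{Z}$, $L(t)$ is a real $n\times n$ matrix, $V(t,\cdot)\in C^1(\mathbb{R}^n,\mathbb{R})$ with gradient $V'_x(t,\cdot)$ and $V'_x(t,0)=0$. (A1) There is a positive integer $T$ with $L(t+T)=L(t)$, $V(t+T,\cdot)=V(t,\cdot)$ for all $t\in\mathbb{Z}$. (A2) $L(t)$ is symmetric and positive definite for all $t\in\mathbb{Z}$. (A3) $V(t,0)=0$ and $|V'_x(t,x)|=o(|x|)$ as $x\to0$. (A4) There are constants $\beta>2$ and $0<\alpha<\beta/2-1$ with $\beta V(t,x)-\langle V'_x(t,x),x\rangle\le\alpha\langle x,L(t)x\rangle$ for all $(t,x)\in\mathbb{Z}\times\mathbb{R}^n$. (A5) There is $(t_0,x_0)\in\mathbb{Z}\times\mathbb{R}^n$, $x_0\ne0$, with $V(t_0,x_0)-\tfrac12\langle x_0,L(t_0)x_0\rangle>0$. *)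

theory Defs
  imports "HOL-Analysis.Analysis" "HOL-Library.Landau_Symbols"
begin

definition fdiff :: "(int \<Rightarrow> 'a::ab_group_add) \<Rightarrow> int \<Rightarrow> 'a" where
  "fdiff x t = x (t + 1) - x t"

definition pos_def_matrix :: "real ^ 'n ^ 'n \<Rightarrow> bool" where
  "pos_def_matrix A \<longleftrightarrow> (\<forall>x. x \<noteq> 0 \<longrightarrow> x \<bullet> (A *v x) > 0)"

definition C1_with_gradient :: "('a::real_inner \<Rightarrow> real) \<Rightarrow> ('a \<Rightarrow> 'a) \<Rightarrow> bool" where
  "C1_with_gradient f g \<longleftrightarrow> (\<forall>x. GDERIV f x :> g x) \<and> continuous_on UNIV g"

(* L, V' are the coefficients of
   Delta^2 x(t-1) - L(t) x(t) + V'(t, x(t)) = 0, where Delta^2 x(t-1) is the twice iterated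
   forward difference evaluated at t - 1, i.e. x(t+1) - 2 x(t) + x(t-1). *)
definition is_solution ::
  "(int \<Rightarrow> real ^ 'n ^ 'n) \<Rightarrow> (int \<Rightarrow> real ^ 'n \<Rightarrow> real ^ 'n) \<Rightarrow> (int \<Rightarrow> real ^ 'n) \<Rightarrow> bool" where
  "is_solution L V' x \<longleftrightarrow> (\<forall>t. fdiff (fdiff x) (t - 1) - L t *v x t + V' t (x t) = 0)"

definition nontrivial_homoclinic ::
  "(int \<Rightarrow> real ^ 'n ^ 'n) \<Rightarrow> (int \<Rightarrow> real ^ 'n \<Rightarrow> real ^ 'n) \<Rightarrow> (int \<Rightarrow> real ^ 'n) \<Rightarrow> bool" where
  "nontrivial_homoclinic L V' x \<longleftrightarrow>
     is_solution L V' x \<and> (\<exists>t. x t \<noteq> 0) \<and> (x \<longlongrightarrow> 0) at_top \<and> (x \<longlongrightarrow> 0) at_bot"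

end

theory Submission
  imports Defs "HOL-Complex_Analysis.Great_Picard"
begin

text \<open>
Homoclinic orbits are the nonzero square summable critical points of the action
\<open>\<Sum>t. |x(t) - x(t-1)|\<^sup>2 / 2 + F t (x t)\<close>, where \<open>F t v = \<langle>v, L(t)v\<rangle> / 2 - V(t, v)\<close>.
The hypotheses give this action a mountain pass shape. By positive definiteness of \<open>L\<close> and \<open>V' = o(|x|)\<close>
the origin is a strict local minimum with a barrier around it. By \<open>A4\<close>, \<open>F\<close> satisfies the
Ambrosetti-Rabinowitz inequality \<open>\<beta> F - \<langle>F', v\<rangle> \<ge> \<kappa> |v|\<^sup>2\<close>; hence the negative value of \<open>F\<close> provided by
\<open>A5\<close> is amplified at the rate \<open>s powr \<beta>\<close> along its ray and outweighs the kinetic energy of a spike at a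
single site (\<open>superhomogeneous_beats_quadratic\<close>).

Almost critical sequences at a positive level are produced by flowing the segment from \<open>0\<close> to such a spike
along a time-discrete normalised gradient descent (\<open>palais_smale\<close>). By the intermediate
value theorem some trajectory ends on the barrier; it has lost only a bounded amount of energy in a
long time, so the gradient is small somewhere along it. All sequences that occur have finite support, so neither
a complete sequence space nor a minimax principle is involved. What makes the discretisation work is an
estimate of the increments of \<open>V'\<close> that can be summed over arbitrarily many sites
(\<open>almost_small_modulus\<close>), since the supports grow as the step size shrinks.

The Ambrosetti-Rabinowitz inequality bounds the almost critical sequences in \<open>\<ell>\<^sup>2\<close>
(\<open>energy_bounds_l2norm\<close>), and their positive energy prevents them from becoming uniformly small
(\<open>energy_small_if_everywhere_small\<close>). By periodicity they can be translated so that a large entry lies in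
\<open>{0..<T}\<close>. A pointwise convergent subsequence then has a limit that solves the equation, is not zero, and is
square summable, so it tends to zero at both ends (\<open>homoclinic_exists\<close>).
\<close>

section \<open>Finitely supported sequences\<close>

text \<open>
The entries at \<open>a\<close> and \<open>b\<close> vanish as well. Thus every jump of such a sequence lies within the window
\<open>{a..b}\<close>, and sums over that window can be shifted by one place.
\<close>

definition supported :: "int \<Rightarrow> int \<Rightarrow> (int \<Rightarrow> 'a::zero) \<Rightarrow> bool" where
  "supported a b x \<longleftrightarrow> (\<forall>t. t \<le> a \<or> b \<le> t \<longrightarrow> x t = 0)"

definition l2norm :: "int \<Rightarrow> int \<Rightarrow> (int \<Rightarrow> 'a::real_normed_vector) \<Rightarrow> real" where
  "l2norm a b x = L2_set (\<lambda>t. norm (x t)) {a..b}"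

lemma supportedD: "supported a b x \<Longrightarrow> t \<le> a \<or> b \<le> t \<Longrightarrow> x t = 0"
  by (auto simp: supported_def)

lemma supported_mono: "supported a b x \<Longrightarrow> a' \<le> a \<Longrightarrow> b \<le> b' \<Longrightarrow> supported a' b' x"
  by (auto simp: supported_def)

lemma l2norm_nonneg [simp]: "0 \<le> l2norm a b x"
  by (simp add: l2norm_def L2_set_nonneg)

lemma l2norm_power2: "(l2norm a b x)\<^sup>2 = (\<Sum>t\<in>{a..b}. (norm (x t))\<^sup>2)"
  by (simp add: l2norm_def L2_set_def sum_nonneg)

lemma l2norm_triangle: "l2norm a b (\<lambda>t. x t + y t) \<le> l2norm a b x + l2norm a b y"
proof -
  have "l2norm a b (\<lambda>t. x t + y t) \<le> L2_set (\<lambda>t. norm (x t) + norm (y t)) {a..b}"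
    unfolding l2norm_def by (intro L2_set_mono norm_triangle_ineq) auto
  also have "\<dots> \<le> l2norm a b x + l2norm a b y"
    unfolding l2norm_def by (rule L2_set_triangle_ineq)
  finally show ?thesis .
qed

lemma l2norm_scaleR: "l2norm a b (\<lambda>t. k *\<^sub>R x t) = \<bar>k\<bar> * l2norm a b x"
  by (simp add: l2norm_def L2_set_right_distrib)

lemma l2norm_mult_ineq:
  "(\<Sum>t\<in>{a..b}. norm (x t) * norm (y t)) \<le> l2norm a b x * l2norm a b y"
  unfolding l2norm_def using L2_set_mult_ineq[of "\<lambda>t. norm (x t)" "\<lambda>t. norm (y t)" "{a..b}"] by simp

lemma l2norm_inner_ineq:
  fixes x y :: "int \<Rightarrow> 'a::real_inner"
  shows "\<bar>\<Sum>t\<in>{a..b}. x t \<bullet> y t\<bar> \<le> l2norm a b x * l2norm a b y"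
proof -
  have "\<bar>\<Sum>t\<in>{a..b}. x t \<bullet> y t\<bar> \<le> (\<Sum>t\<in>{a..b}. norm (x t) * norm (y t))"
    by (rule order_trans[OF sum_abs]) (intro sum_mono Cauchy_Schwarz_ineq2)
  then show ?thesis
    using l2norm_mult_ineq order_trans by blast
qed

lemma norm_le_l2norm:
  assumes "supported a b x"
  shows "norm (x t) \<le> l2norm a b x"
proof (cases "t \<in> {a..b}")
  case True
  then show ?thesis
    unfolding l2norm_def by (intro member_le_L2_set) auto
next
  case False
  then have "x t = 0" using assms by (auto simp: supported_def)
  then show ?thesis by simp
qed

text \<open>
The window only serves to keep sums finite. This bound removes it, so that it can pass to limits
of sequences whose windows grow.
\<close>

lemma sum_norm_le_l2norm:
  assumes "supported a b x" "finite A"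
  shows "(\<Sum>t\<in>A. (norm (x t))\<^sup>2) \<le> (l2norm a b x)\<^sup>2"
proof -
  have "(\<Sum>t\<in>A. (norm (x t))\<^sup>2) = (\<Sum>t\<in>A \<inter> {a..b}. (norm (x t))\<^sup>2)"
  proof (intro sum.mono_neutral_right ballI)
    fix t assume "t \<in> A - A \<inter> {a..b}"
    then have "x t = 0" by (intro supportedD[OF assms(1)]) auto
    then show "(norm (x t))\<^sup>2 = 0" by simp
  qed (use assms in auto)
  also have "\<dots> \<le> (\<Sum>t\<in>{a..b}. (norm (x t))\<^sup>2)"
    by (intro sum_mono2) auto
  finally show ?thesis by (simp add: l2norm_power2)
qed

text \<open>
The index shift that underlies summation by parts: it moves the terms of the window one place,
losing only the value at the right end and gaining only the one just before the left end.
\<close>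

lemma sum_shift_supported:
  fixes g :: "int \<Rightarrow> 'b::ab_group_add"
  assumes "g (a - 1) = 0" "g b = 0"
  shows "(\<Sum>t\<in>{a..b}. g (t - 1)) = (\<Sum>t\<in>{a..b}. g t)"
proof -
  have "(\<Sum>t\<in>{a..b}. g (t - 1)) = (\<Sum>t\<in>{a-1..b-1}. g t)"
    by (rule sum.reindex_bij_witness[of _ "\<lambda>t. t + 1" "\<lambda>t. t - 1"]) auto
  also have "\<dots> = (\<Sum>t\<in>{a-1..b}. g t)"
  proof (intro sum.mono_neutral_left ballI)
    fix t assume "t \<in> {a-1..b} - {a-1..b-1}"
    then have "t = b" by auto
    then show "g t = 0" using assms by simp
  qed auto
  also have "\<dots> = (\<Sum>t\<in>{a..b}. g t)"
  proof (intro sum.mono_neutral_right ballI)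
    fix t assume "t \<in> {a-1..b} - {a..b}"
    then have "t = a - 1" by auto
    then show "g t = 0" using assms by simp
  qed auto
  finally show ?thesis .
qed

text \<open>
Identifies the negative discrete Laplacian as the gradient of the kinetic energy. No boundary terms
survive because the test sequence \<open>w\<close> vanishes at both ends of the window and beyond.
\<close>

lemma sum_by_parts:
  fixes x w :: "int \<Rightarrow> 'a::real_inner"
  assumes "supported a b w"
  shows "(\<Sum>t\<in>{a..b}. (x t - x (t - 1)) \<bullet> (w t - w (t - 1)))
       = (\<Sum>t\<in>{a..b}. (2 *\<^sub>R x t - x (t - 1) - x (t + 1)) \<bullet> w t)"
proof -
  have "(\<Sum>t\<in>{a..b}. (x t - x (t - 1)) \<bullet> w (t - 1))
      = (\<Sum>t\<in>{a..b}. (x (t + 1) - x t) \<bullet> w t)"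
    using sum_shift_supported[of "\<lambda>t. (x (t + 1) - x t) \<bullet> w t" a b] assms
    by (simp add: supported_def)
  then show ?thesis
    by (simp add: inner_diff_right sum_subtractf inner_diff_left sum_distrib_left)
qed

lemma sum_diff_le:
  fixes w :: "int \<Rightarrow> 'a::real_inner"
  assumes "supported a b w"
  shows "(\<Sum>t\<in>{a..b}. (norm (w t - w (t - 1)))\<^sup>2) \<le> 4 * (l2norm a b w)\<^sup>2"
proof -
  have *: "(norm (u - v))\<^sup>2 \<le> 2 * (norm u)\<^sup>2 + 2 * (norm v)\<^sup>2" for u v :: 'a
  proof -
    have "0 \<le> (norm (u + v))\<^sup>2" by simp
    then show ?thesis
      by (simp add: power2_norm_eq_inner inner_simps inner_commute)
  qed
  have "(\<Sum>t\<in>{a..b}. (norm (w t - w (t - 1)))\<^sup>2)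
      \<le> (\<Sum>t\<in>{a..b}. 2 * (norm (w t))\<^sup>2 + 2 * (norm (w (t - 1)))\<^sup>2)"
    by (intro sum_mono *)
  also have "\<dots> = 2 * (\<Sum>t\<in>{a..b}. (norm (w t))\<^sup>2) + 2 * (\<Sum>t\<in>{a..b}. (norm (w (t - 1)))\<^sup>2)"
    by (simp add: sum.distrib sum_distrib_left)
  also have "(\<Sum>t\<in>{a..b}. (norm (w (t - 1)))\<^sup>2) = (\<Sum>t\<in>{a..b}. (norm (w t))\<^sup>2)"
    using assms by (intro sum_shift_supported[of "\<lambda>t. (norm (w t))\<^sup>2"]) (auto simp: supported_def)
  finally show ?thesis by (simp add: l2norm_power2)
qed

section \<open>Periodicity and decay of sequences on the integers\<close>

lemma periodic_add_multiple:
  fixes g :: "int \<Rightarrow> 'b"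
  assumes "\<And>t. g (t + T) = g t"
  shows "g (t + k * T) = g t"
proof (induction k rule: int_induct[of _ 0])
  case (step1 i)
  then show ?case using assms[of "t + i * T"] by (simp add: algebra_simps)
next
  case (step2 i)
  then show ?case using assms[of "t + (i - 1) * T"] by (simp add: algebra_simps)
qed simp

text \<open>
All constants below are found separately for each site. Periodicity leaves only the finitely many
sites of one period, and finitely many \<open>eventually\<close> statements hold simultaneously; working with
filters treats small radii and large constants alike.
\<close>

lemma eventually_all_periodic:
  fixes Q :: "int \<Rightarrow> 'b \<Rightarrow> bool"
  assumes per: "\<And>t. Q (t + T) = Q t" and "0 < T" and ev: "\<And>t. eventually (Q t) G"
  shows "eventually (\<lambda>y. \<forall>t. Q t y) G"
proof -
  have "eventually (\<lambda>y. \<forall>t\<in>{0..<T}. Q t y) G"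
    by (intro eventually_ball_finite ballI ev) simp
  then show ?thesis
  proof (rule eventually_mono, intro allI)
    fix y t assume y: "\<forall>t\<in>{0..<T}. Q t y"
    have "Q t = Q (t mod T + t div T * T)" by simp
    also have "\<dots> = Q (t mod T)" by (rule periodic_add_multiple[of Q, OF per])
    finally show "Q t y" using y \<open>0 < T\<close> by simp
  qed
qed

lemma tendsto_zero_if_square_summable:
  fixes x :: "int \<Rightarrow> 'a::real_normed_vector"
  assumes M: "\<And>A. finite A \<Longrightarrow> (\<Sum>t\<in>A. (norm (x t))\<^sup>2) \<le> M"
  shows "(x \<longlongrightarrow> 0) at_top" and "(x \<longlongrightarrow> 0) at_bot"
proof -
  have fin: "finite {t. \<not> norm (x t) < e}" if "0 < e" for e
  proof (rule ccontr)
    assume inf: "infinite {t. \<not> norm (x t) < e}"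
    obtain n :: nat where n: "M / e\<^sup>2 < real n" using reals_Archimedean2 by blast
    obtain A where A: "A \<subseteq> {t. \<not> norm (x t) < e}" "finite A" "card A = n"
      using infinite_arbitrarily_large[OF inf] by blast
    have "real n * e\<^sup>2 = (\<Sum>t\<in>A. e\<^sup>2)" using A by simp
    also have "\<dots> \<le> (\<Sum>t\<in>A. (norm (x t))\<^sup>2)"
      using A that by (intro sum_mono power_mono) auto
    also have "\<dots> \<le> M" using A M by blast
    finally show False using n that by (simp add: pos_divide_less_eq)
  qed
  have "\<forall>\<^sub>F t in at_top. norm (x t) < e" if "0 < e" for e
  proof -
    have "\<forall>\<^sub>F t in at_top. \<forall>s\<in>{t. \<not> norm (x t) < e}. s < t"
      by (intro eventually_ball_finite fin that ballI eventually_gt_at_top)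
    then show ?thesis by (rule eventually_mono) auto
  qed
  then show "(x \<longlongrightarrow> 0) at_top" by (simp add: tendsto_iff)
  have "\<forall>\<^sub>F t in at_bot. norm (x t) < e" if "0 < e" for e
  proof -
    have below: "\<forall>\<^sub>F t in at_bot. t < s" for s :: int
      unfolding eventually_at_bot_dense by auto
    have "\<forall>\<^sub>F t in at_bot. \<forall>s\<in>{t. \<not> norm (x t) < e}. t < s"
      by (intro eventually_ball_finite fin that ballI below)
    then show ?thesis by (rule eventually_mono) auto
  qed
  then show "(x \<longlongrightarrow> 0) at_bot" by (simp add: tendsto_iff)
qed

section \<open>Gradients and quadratic forms\<close>

lemma GDERIV_unique:
  assumes "GDERIV f x :> D" "GDERIV f x :> D'"
  shows "D = D'"
proof -
  have "(\<lambda>h. h \<bullet> D) = (\<lambda>h. h \<bullet> D')"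
    using assms unfolding gderiv_def by (rule has_derivative_unique)
  then show ?thesis
    by (metis vector_eq_rdot inner_commute)
qed

lemma DERIV_along_line:
  assumes "\<And>y. GDERIV f y :> g y"
  shows "((\<lambda>s. f (x + s *\<^sub>R u)) has_field_derivative (g (x + s *\<^sub>R u) \<bullet> u)) (at s within S)"
proof -
  have "((\<lambda>s. x + s *\<^sub>R u) has_derivative (\<lambda>h. h *\<^sub>R u)) (at s within S)"
    by (auto intro!: derivative_eq_intros)
  moreover have "(f has_derivative (\<lambda>h. h \<bullet> g (x + s *\<^sub>R u))) (at (x + s *\<^sub>R u))"
    using assms by (simp add: gderiv_def)
  ultimately have "((\<lambda>s. f (x + s *\<^sub>R u)) has_derivative (\<lambda>h. (h *\<^sub>R u) \<bullet> g (x + s *\<^sub>R u))) (at s within S)"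
    by (rule has_derivative_compose)
  moreover have "(\<lambda>h. (h *\<^sub>R u) \<bullet> g (x + s *\<^sub>R u)) = (*) (g (x + s *\<^sub>R u) \<bullet> u)"
    by (auto simp: inner_commute mult.commute)
  ultimately show ?thesis
    by (simp add: has_field_derivative_def)
qed

lemma gradient_mean_value:
  assumes "\<And>y. GDERIV f y :> g y"
  obtains \<theta> where "0 < \<theta>" "\<theta> < 1" "f (x + u) - f x = g (x + \<theta> *\<^sub>R u) \<bullet> u"
proof -
  have "\<exists>z. 0 < z \<and> z < 1 \<and> f (x + 1 *\<^sub>R u) - f (x + 0 *\<^sub>R u) = (1 - 0) * (g (x + z *\<^sub>R u) \<bullet> u)"
    by (rule MVT2) (auto intro: DERIV_along_line[OF assms])
  then show thesis using that by auto
qed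

text \<open>
Plain uniform continuity on a ball bounds \<open>norm (g y - g x)\<close> by a constant, and such a bound cannot
be summed over an unbounded number of sites. Here each term of the bound carries a factor
\<open>norm x\<close> or \<open>norm (y - x)\<close>, so it is summable against \<open>\<ell>\<^sup>2\<close> norms independently of the size of the
support. Near the origin the smallness of \<open>g\<close> is used; away from it, \<open>norm x\<close> is bounded below, which
turns a constant error into a multiple of \<open>norm x\<close>; and if \<open>x\<close> and \<open>y\<close> are far apart then
\<open>norm (y - x)\<close> is bounded below.
\<close>

lemma almost_small_modulus:
  fixes g :: "'a::euclidean_space \<Rightarrow> 'a"
  assumes cont: "continuous_on UNIV g" and "0 < R" "0 < \<epsilon>"
    and "0 < \<delta>" and small: "\<And>x. norm x \<le> \<delta> \<Longrightarrow> norm (g x) \<le> \<epsilon> / 2 * norm x"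
  shows "\<forall>\<^sub>F C in at_top. \<forall>x y. norm x \<le> R \<longrightarrow> norm y \<le> R \<longrightarrow>
           norm (g y - g x) \<le> \<epsilon> * norm x + C * norm (y - x)"
proof -
  have contR: "continuous_on (cball 0 R) g"
    by (rule continuous_on_subset[OF cont]) simp
  have "bounded (g ` cball 0 R)"
    by (intro compact_imp_bounded compact_continuous_image contR compact_cball)
  then obtain M where M: "0 < M" "\<And>x. norm x \<le> R \<Longrightarrow> norm (g x) \<le> M"
    by (auto simp: bounded_pos)
  have "uniformly_continuous_on (cball 0 R) g"
    by (intro compact_uniformly_continuous contR compact_cball)
  moreover have "0 < \<epsilon> * \<delta> / 2" using assms by simp
  ultimately obtain d0 where d0: "0 < d0"
    "\<And>x y. norm x \<le> R \<Longrightarrow> norm y \<le> R \<Longrightarrow> norm (y - x) < d0 \<Longrightarrow> norm (g y - g x) < \<epsilon> * \<delta> / 2"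
    unfolding uniformly_continuous_on_def by (metis dist_norm mem_cball_0)
  \<comment> \<open>the bound \<open>\<delta> / 2\<close> keeps a point near the half ball inside the ball where \<open>small\<close> applies\<close>
  define d where "d = min d0 (\<delta> / 2)"
  have d: "0 < d" "d \<le> d0" "d \<le> \<delta> / 2" using d0 assms by (auto simp: d_def)
  have "norm (g y - g x) \<le> \<epsilon> * norm x + C * norm (y - x)"
    if C: "max (2 * M / d) \<epsilon> \<le> C" and xy: "norm x \<le> R" "norm y \<le> R" for C x y
  proof (cases "norm (y - x) < d")
    case False
    have "norm (g y - g x) \<le> 2 * M / d * d"
      using norm_triangle_ineq4[of "g y" "g x"] M(2)[OF xy(1)] M(2)[OF xy(2)] d by simp
    also have "\<dots> \<le> C * norm (y - x)"
      using False C d M \<open>0 < \<epsilon>\<close> by (intro mult_mono) auto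
    finally show ?thesis using \<open>0 < \<epsilon>\<close> by (simp add: add_increasing)
  next
    case near: True
    show ?thesis
    proof (cases "norm x \<le> \<delta> / 2")
      case True
      have tri: "norm y \<le> norm x + norm (y - x)"
        using norm_triangle_ineq[of x "y - x"] by simp
      have "norm (g y) \<le> \<epsilon> / 2 * norm y" and "norm (g x) \<le> \<epsilon> / 2 * norm x"
        using tri True near d by (intro small; linarith)+
      then have "norm (g y - g x) \<le> \<epsilon> / 2 * norm y + \<epsilon> / 2 * norm x"
        using norm_triangle_ineq4[of "g y" "g x"] by simp
      also have "\<dots> \<le> \<epsilon> / 2 * (norm x + norm (y - x)) + \<epsilon> / 2 * norm x"
        using tri \<open>0 < \<epsilon>\<close> by simp
      also have "\<dots> = \<epsilon> * norm x + \<epsilon> / 2 * norm (y - x)" by (simp add: field_simps)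
      also have "\<epsilon> / 2 * norm (y - x) \<le> C * norm (y - x)"
        using C \<open>0 < \<epsilon>\<close> by (intro mult_right_mono) auto
      finally show ?thesis by simp
    next
      case False
      have "norm (g y - g x) \<le> \<epsilon> * (\<delta> / 2)" using d0(2)[OF xy] near d by simp
      also have "\<dots> \<le> \<epsilon> * norm x" using False \<open>0 < \<epsilon>\<close> by (intro mult_left_mono) auto
      finally show ?thesis using C \<open>0 < \<epsilon>\<close> by (simp add: add_increasing2)
    qed
  qed
  then show ?thesis
    unfolding eventually_at_top_linorder by blast
qed

text \<open>
The hypothesis says precisely that \<open>s powr (- \<beta>) * F (s *\<^sub>R e)\<close> has nonpositive derivative
for \<open>s > 0\<close>.
\<close>

lemma superhomogeneous_scaling:
  fixes F :: "'a::real_inner \<Rightarrow> real"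
  assumes grad: "\<And>y. GDERIV F y :> f y" and sup: "\<And>y. f y \<bullet> y \<le> \<beta> * F y" and "1 \<le> s"
  shows "F (s *\<^sub>R e) \<le> s powr \<beta> * F e"
proof -
  have "s powr (- \<beta>) * F (s *\<^sub>R e) \<le> 1 powr (- \<beta>) * F (1 *\<^sub>R e)"
  proof (rule DERIV_nonpos_imp_nonincreasing[OF \<open>1 \<le> s\<close>])
    fix x :: real assume "1 \<le> x"
    then have x: "0 < x" by simp
    have "((\<lambda>s. F (s *\<^sub>R e)) has_field_derivative (f (x *\<^sub>R e) \<bullet> e)) (at x)"
      using DERIV_along_line[OF grad, where x = 0 and u = e] by simp
    then have "((\<lambda>s. s powr (- \<beta>) * F (s *\<^sub>R e)) has_field_derivative
        (- \<beta> * x powr (- \<beta> - 1)) * F (x *\<^sub>R e) + f (x *\<^sub>R e) \<bullet> e * x powr (- \<beta>)) (at x)"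
      using x by (intro DERIV_mult has_real_derivative_powr)
    moreover have "(- \<beta> * x powr (- \<beta> - 1)) * F (x *\<^sub>R e) + f (x *\<^sub>R e) \<bullet> e * x powr (- \<beta>)
        = x powr (- \<beta> - 1) * (f (x *\<^sub>R e) \<bullet> (x *\<^sub>R e) - \<beta> * F (x *\<^sub>R e))"
      using x by (simp add: powr_diff field_simps)
    moreover have "\<dots> \<le> 0"
      using sup[of "x *\<^sub>R e"] by (intro mult_nonneg_nonpos) auto
    ultimately show "\<exists>D. ((\<lambda>s. s powr (- \<beta>) * F (s *\<^sub>R e)) has_field_derivative D) (at x) \<and> D \<le> 0"
      by metis
  qed
  then show ?thesis
    using \<open>1 \<le> s\<close> by (simp add: powr_minus field_simps)
qed

text \<open>
A single negative value of \<open>F\<close> is amplified along its ray at the rate \<open>s powr \<beta>\<close>, faster than the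
kinetic cost \<open>s\<^sup>2 * (norm e)\<^sup>2\<close> of a spike of height \<open>s * norm e\<close> at one site.
\<close>

lemma superhomogeneous_beats_quadratic:
  fixes F :: "'a::real_inner \<Rightarrow> real"
  assumes grad: "\<And>y. GDERIV F y :> f y" and sup: "\<And>y. f y \<bullet> y \<le> \<beta> * F y"
    and "2 < \<beta>" and neg: "F e < 0"
  shows "\<exists>e. F e + (norm e)\<^sup>2 < 0"
proof -
  define q where "q = (norm e)\<^sup>2 / (- F e)"
  have q: "0 \<le> q" using neg by (simp add: q_def divide_nonneg_neg)
  \<comment> \<open>chosen so that \<open>s powr \<beta> = s\<^sup>2 * (q + 1)\<close>\<close>
  define s where "s = (q + 1) powr (1 / (\<beta> - 2))"
  have s: "1 \<le> s" unfolding s_def using q \<open>2 < \<beta>\<close> by (intro ge_one_powr_ge_zero) auto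
  have "s powr \<beta> = s powr 2 * s powr (\<beta> - 2)" by (simp add: powr_add[symmetric])
  also have "s powr (\<beta> - 2) = q + 1"
    using q \<open>2 < \<beta>\<close> by (simp add: s_def powr_powr)
  also have "s powr 2 = s\<^sup>2" using s by (simp add: powr_numeral)
  finally have "s powr \<beta> * F e = s\<^sup>2 * ((q + 1) * F e)" by simp
  also have "(q + 1) * F e = F e - (norm e)\<^sup>2" using neg by (simp add: q_def field_simps)
  finally have "F (s *\<^sub>R e) \<le> s\<^sup>2 * (F e - (norm e)\<^sup>2)"
    using superhomogeneous_scaling[OF grad sup s] by metis
  moreover have "s\<^sup>2 * F e < 0" using s neg by (simp add: mult_pos_neg)
  ultimately have "F (s *\<^sub>R e) + (norm (s *\<^sub>R e))\<^sup>2 < 0"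
    by (simp add: power_mult_distrib right_diff_distrib)
  then show ?thesis by blast
qed

text \<open>
Any constant below the minimum of the form over the unit sphere works, and that minimum is attained,
hence positive, because the sphere is compact.
\<close>

lemma pos_def_matrix_coercive:
  fixes A :: "real ^ 'n ^ 'n"
  assumes "pos_def_matrix A"
  shows "\<forall>\<^sub>F l in at_right 0. \<forall>x. l * (norm x)\<^sup>2 \<le> x \<bullet> (A *v x)"
proof -
  have "continuous_on (sphere 0 1) (\<lambda>x. x \<bullet> (A *v x))"
    by (intro continuous_intros linear_continuous_on matrix_vector_mul_bounded_linear)
  moreover have "sphere (0 :: real ^ 'n) 1 \<noteq> {}" by simp
  ultimately obtain u where u: "norm u = 1" "\<And>y. norm y = 1 \<Longrightarrow> u \<bullet> (A *v u) \<le> y \<bullet> (A *v y)"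
    using continuous_attains_inf[OF compact_sphere, of 0 1 "\<lambda>x. x \<bullet> (A *v x)"] by auto
  have "u \<noteq> 0" using u(1) by auto
  then have "0 < u \<bullet> (A *v u)" using assms by (simp add: pos_def_matrix_def)
  then have "\<forall>\<^sub>F l in at_right 0. l < u \<bullet> (A *v u)"
    by (simp add: eventually_at_right_field) blast
  then show ?thesis
  proof (rule eventually_mono, intro allI)
    fix l and x :: "real ^ 'n" assume l: "l < u \<bullet> (A *v u)"
    show "l * (norm x)\<^sup>2 \<le> x \<bullet> (A *v x)"
    proof (cases "x = 0")
      case False
      have "l \<le> (x /\<^sub>R norm x) \<bullet> (A *v (x /\<^sub>R norm x))"
        using u(2)[of "x /\<^sub>R norm x"] l False by simp
      also have "\<dots> = (x \<bullet> (A *v x)) / (norm x)\<^sup>2"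
        by (simp add: matrix_vector_mult_scaleR power2_eq_square divide_inverse)
      finally show ?thesis using False by (simp add: pos_le_divide_eq)
    qed simp
  qed
qed

lemma quadratic_form_bound:
  fixes A :: "real ^ 'n ^ 'n"
  shows "\<forall>\<^sub>F K in at_top. \<forall>x. x \<bullet> (A *v x) \<le> K * (norm x)\<^sup>2"
proof (rule eventually_mono[OF eventually_ge_at_top[of "onorm ((*v) A)"]], intro allI)
  fix K and x :: "real ^ 'n" assume K: "onorm ((*v) A) \<le> K"
  have "x \<bullet> (A *v x) \<le> norm x * norm (A *v x)" by (rule norm_cauchy_schwarz)
  also have "\<dots> \<le> norm x * (K * norm x)"
    using onorm[OF matrix_vector_mul_bounded_linear, of A x] K
    by (intro mult_left_mono order_trans[OF _ mult_right_mono[OF K]]) auto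
  finally show "x \<bullet> (A *v x) \<le> K * (norm x)\<^sup>2" by (simp add: power2_eq_square mult_ac)
qed

lemma symmetric_inner_commute:
  fixes A :: "real ^ 'n ^ 'n"
  assumes "transpose A = A"
  shows "x \<bullet> (A *v y) = (A *v x) \<bullet> y"
  using dot_lmul_matrix[of x A y] transpose_matrix_vector[of A x] assms by simp

lemma GDERIV_quadratic_form:
  fixes A :: "real ^ 'n ^ 'n"
  assumes "transpose A = A"
  shows "GDERIV (\<lambda>x. (1 / 2) * (x \<bullet> (A *v x))) x :> A *v x"
proof -
  have "((*v) A has_derivative (*v) A) (at x)"
    by (rule bounded_linear_imp_has_derivative[OF matrix_vector_mul_bounded_linear])
  then have "((\<lambda>x. (1 / 2) * (x \<bullet> (A *v x))) has_derivative
      (\<lambda>h. (1 / 2) * (x \<bullet> (A *v h) + h \<bullet> (A *v x)))) (at x)"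
    by (intro has_derivative_mult_right has_derivative_inner has_derivative_ident)
  also have "(\<lambda>h. (1 / 2) * (x \<bullet> (A *v h) + h \<bullet> (A *v x))) = (\<lambda>h. h \<bullet> (A *v x))"
    using symmetric_inner_commute[OF assms] by (auto simp: inner_commute)
  finally show ?thesis by (simp add: gderiv_def)
qed

lemma small_o_imp_le:
  fixes g :: "'a::real_normed_vector \<Rightarrow> 'b::real_normed_vector"
  assumes "(\<lambda>x. norm (g x)) \<in> o[at 0](\<lambda>x. norm x)" "g 0 = 0" "0 < \<epsilon>"
  shows "\<forall>\<^sub>F \<delta> in at_right 0. \<forall>x. norm x \<le> \<delta> \<longrightarrow> norm (g x) \<le> \<epsilon> * norm x"
proof -
  have "\<forall>\<^sub>F x in at 0. norm (g x) \<le> \<epsilon> * norm x"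
    using landau_o.smallD[OF assms(1,3)] by simp
  then obtain d where d: "0 < d" "\<And>x. x \<noteq> 0 \<Longrightarrow> norm x < d \<Longrightarrow> norm (g x) \<le> \<epsilon> * norm x"
    by (auto simp: eventually_at)
  have "\<forall>\<^sub>F \<delta> in at_right 0. \<delta> < d"
    using d(1) by (simp add: eventually_at_right_field) blast
  then show ?thesis
  proof (rule eventually_mono, intro allI impI)
    fix \<delta> and x :: 'a assume "\<delta> < d" "norm x \<le> \<delta>"
    then show "norm (g x) \<le> \<epsilon> * norm x"
      using d(2)[of x] \<open>g 0 = 0\<close> by (cases "x = 0") auto
  qed
qed

section \<open>The action and its descent steps\<close>

text \<open>
The construction of the orbit rests on the following properties of the on-site energy \<open>F\<close> and its gradient \<open>f\<close>.
For the difference equation, \<open>F t v\<close> is \<open>\<langle>v, L(t)v\<rangle> / 2 - V(t, v)\<close>.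

The assumption \<open>F_well\<close> puts a barrier around the origin, and \<open>f_well\<close> keeps almost critical
sequences of positive energy from staying within it. By \<open>valley\<close> there is a spike at one site whose
energy is negative, the kinetic part included, and \<open>superquadratic\<close> is the
Ambrosetti-Rabinowitz condition. That \<open>f\<close> is the gradient of \<open>F\<close> enters
only through \<open>first_order\<close>, a one-sided first-order expansion whose error can be
summed over arbitrarily many sites.
\<close>

locale periodic_lattice =
  fixes F :: "int \<Rightarrow> 'a::euclidean_space \<Rightarrow> real"
    and f :: "int \<Rightarrow> 'a \<Rightarrow> 'a"
    and T :: int and r c \<beta> \<kappa> :: real
  assumes F_cont: "continuous_on UNIV (F t)"
    and f_cont: "continuous_on UNIV (f t)"
    and F_zero [simp]: "F t 0 = 0"
    and f_zero [simp]: "f t 0 = 0"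
    and T_pos: "0 < T"
    and f_periodic: "f (t + T) = f t"
    and r_pos: "0 < r" and r_le_1: "r \<le> 1" and c_pos: "0 < c"
    and F_well: "norm v \<le> r \<Longrightarrow> c * (norm v)\<^sup>2 \<le> F t v"
    and f_well: "norm v \<le> r \<Longrightarrow> c * (norm v)\<^sup>2 \<le> f t v \<bullet> v"
    and \<beta>_gt: "2 < \<beta>" and \<kappa>_pos: "0 < \<kappa>"
    and superquadratic: "\<kappa> * (norm v)\<^sup>2 \<le> \<beta> * F t v - f t v \<bullet> v"
    and first_order: "0 < R \<Longrightarrow> 0 < \<epsilon> \<Longrightarrow> \<exists>C\<ge>0. \<forall>t v u. norm v \<le> R \<longrightarrow> norm u \<le> 1 \<longrightarrow>
          F t (v + u) \<le> F t v + f t v \<bullet> u + \<epsilon> * norm v * norm u + C * (norm u)\<^sup>2"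
    and valley: "\<exists>t e. F t e + (norm e)\<^sup>2 < 0"
begin

text \<open>
The Lagrangian sum over a window. For sequences supported in the window it is the full
action, and its gradient for the \<open>\<ell>\<^sup>2\<close> inner product is \<open>grad\<close>, whose zeros are the
solutions of the difference equation.
\<close>

definition energy :: "int \<Rightarrow> int \<Rightarrow> (int \<Rightarrow> 'a) \<Rightarrow> real" where
  "energy a b x = (\<Sum>t\<in>{a..b}. (norm (x t - x (t - 1)))\<^sup>2 / 2 + F t (x t))"

definition grad :: "(int \<Rightarrow> 'a) \<Rightarrow> int \<Rightarrow> 'a" where
  "grad x t = 2 *\<^sub>R x t - x (t - 1) - x (t + 1) + f t (x t)"

text \<open>
One explicit Euler step of a normalised gradient flow. The normalisation keeps each step no longer than
\<open>h\<close>, so that after total time \<open>S\<close> every trajectory is still in a ball whose radius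
depends only on \<open>S\<close> and the norm of its starting point. Dividing by \<open>1 + g\<^sup>2\<close> rather than by the length \<open>g\<close> of the gradient
keeps the step continuous at critical points and leaves the origin fixed.
\<close>

definition descent :: "int \<Rightarrow> int \<Rightarrow> real \<Rightarrow> (int \<Rightarrow> 'a) \<Rightarrow> int \<Rightarrow> 'a" where
  "descent a b h x = (\<lambda>t. x t + (- (h / (1 + (l2norm a b (grad x))\<^sup>2))) *\<^sub>R grad x t)"

lemma supported_grad:
  "supported a b x \<Longrightarrow> supported (a - 1) (b + 1) (grad x)"
  by (auto simp: supported_def grad_def)

lemma supported_descent:
  "supported a b x \<Longrightarrow> supported (a - 1) (b + 1) (descent a' b' h x)"
  using supported_grad[of a b x] by (auto simp: supported_def descent_def)

text \<open>
The kinetic part is exactly quadratic, and \<open>first_order\<close> is summed site by site. None of the error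
terms depends on the window.
\<close>

lemma energy_first_order:
  assumes C: "\<And>t v u. norm v \<le> R \<Longrightarrow> norm u \<le> 1 \<Longrightarrow>
          F t (v + u) \<le> F t v + f t v \<bullet> u + \<epsilon> * norm v * norm u + C * (norm u)\<^sup>2"
    and "0 \<le> \<epsilon>" and x: "supported a b x" "l2norm a b x \<le> R"
    and u: "supported a b u" "l2norm a b u \<le> 1"
  shows "energy a b (\<lambda>t. x t + u t) \<le> energy a b x + (\<Sum>t\<in>{a..b}. grad x t \<bullet> u t)
           + \<epsilon> * l2norm a b x * l2norm a b u + (C + 2) * (l2norm a b u)\<^sup>2"
proof -
  have "energy a b (\<lambda>t. x t + u t) \<le> (\<Sum>t\<in>{a..b}. ((norm (x t - x (t - 1)))\<^sup>2 / 2 + F t (x t))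
      + ((x t - x (t - 1)) \<bullet> (u t - u (t - 1)) + f t (x t) \<bullet> u t)
      + \<epsilon> * (norm (x t) * norm (u t)) + C * (norm (u t))\<^sup>2 + (norm (u t - u (t - 1)))\<^sup>2 / 2)"
    unfolding energy_def
  proof (rule sum_mono)
    fix t
    have "(norm (x t + u t - (x (t - 1) + u (t - 1))))\<^sup>2 / 2
        = (norm (x t - x (t - 1)))\<^sup>2 / 2 + (x t - x (t - 1)) \<bullet> (u t - u (t - 1))
          + (norm (u t - u (t - 1)))\<^sup>2 / 2"
      by (simp add: power2_norm_eq_inner inner_simps inner_commute field_simps)
    moreover have "F t (x t + u t) \<le> F t (x t) + f t (x t) \<bullet> u t + \<epsilon> * norm (x t) * norm (u t)
        + C * (norm (u t))\<^sup>2"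
      using C norm_le_l2norm[OF x(1), of t] norm_le_l2norm[OF u(1), of t] x u by force
    ultimately show "(norm (x t + u t - (x (t - 1) + u (t - 1))))\<^sup>2 / 2 + F t (x t + u t)
      \<le> ((norm (x t - x (t - 1)))\<^sup>2 / 2 + F t (x t))
      + ((x t - x (t - 1)) \<bullet> (u t - u (t - 1)) + f t (x t) \<bullet> u t)
      + \<epsilon> * (norm (x t) * norm (u t)) + C * (norm (u t))\<^sup>2 + (norm (u t - u (t - 1)))\<^sup>2 / 2"
      by (simp add: mult.assoc add_divide_distrib)
  qed
  also have "\<dots> = energy a b x
      + ((\<Sum>t\<in>{a..b}. (x t - x (t - 1)) \<bullet> (u t - u (t - 1))) + (\<Sum>t\<in>{a..b}. f t (x t) \<bullet> u t))
      + \<epsilon> * (\<Sum>t\<in>{a..b}. norm (x t) * norm (u t)) + C * (l2norm a b u)\<^sup>2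
      + (\<Sum>t\<in>{a..b}. (norm (u t - u (t - 1)))\<^sup>2) / 2"
    by (simp add: sum.distrib sum_distrib_left sum_divide_distrib energy_def l2norm_power2)
  also have "(\<Sum>t\<in>{a..b}. (x t - x (t - 1)) \<bullet> (u t - u (t - 1))) + (\<Sum>t\<in>{a..b}. f t (x t) \<bullet> u t)
      = (\<Sum>t\<in>{a..b}. grad x t \<bullet> u t)"
    unfolding sum_by_parts[OF u(1)] by (simp add: grad_def sum.distrib[symmetric] inner_add_left)
  also have "\<epsilon> * (\<Sum>t\<in>{a..b}. norm (x t) * norm (u t)) \<le> \<epsilon> * (l2norm a b x * l2norm a b u)"
    using l2norm_mult_ineq \<open>0 \<le> \<epsilon>\<close> by (rule mult_left_mono)
  also have "(\<Sum>t\<in>{a..b}. (norm (u t - u (t - 1)))\<^sup>2) / 2 \<le> 2 * (l2norm a b u)\<^sup>2"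
    using sum_diff_le[OF u(1)] by simp
  finally show ?thesis by (simp add: algebra_simps)
qed

lemma descent_length:
  assumes "0 \<le> h"
  shows "h / (1 + (l2norm a b (grad x))\<^sup>2) * l2norm a b (grad x) \<le> h"
proof -
  let ?g = "l2norm a b (grad x)"
  have "0 < 1 + ?g\<^sup>2" by (simp add: add_pos_nonneg)
  moreover have "?g \<le> 1 + ?g\<^sup>2"
    using sum_squares_bound[of ?g 1] l2norm_nonneg[of a b "grad x"] by (simp, linarith)
  ultimately show ?thesis
    using assms by (simp add: divide_simps mult_left_mono)
qed

lemma l2norm_descent:
  assumes "0 \<le> h"
  shows "l2norm a b (descent a b h x) \<le> l2norm a b x + h"
proof -
  have "0 < 1 + (l2norm a b (grad x))\<^sup>2" by (simp add: add_pos_nonneg)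
  then have "0 \<le> h / (1 + (l2norm a b (grad x))\<^sup>2)" using assms by simp
  then have "l2norm a b (\<lambda>t. (- (h / (1 + (l2norm a b (grad x))\<^sup>2))) *\<^sub>R grad x t) \<le> h"
    unfolding l2norm_scaleR using descent_length[OF assms, of a b x]
    by (simp only: abs_minus_cancel abs_of_nonneg)
  then show ?thesis
    unfolding descent_def
    using l2norm_triangle[of a b x "\<lambda>t. (- (h / (1 + (l2norm a b (grad x))\<^sup>2))) *\<^sub>R grad x t"]
    by simp
qed

text \<open>
The loss is governed by the length of the gradient, and the error per unit time, \<open>\<epsilon> * R + (C + 2) * h\<close>,
can be made as small as desired by choosing first \<open>\<epsilon>\<close> and then \<open>h\<close>.
\<close>

lemma energy_descent:
  assumes C: "\<And>t v u. norm v \<le> R \<Longrightarrow> norm u \<le> 1 \<Longrightarrow>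
          F t (v + u) \<le> F t v + f t v \<bullet> u + \<epsilon> * norm v * norm u + C * (norm u)\<^sup>2"
    and \<epsilon>: "0 \<le> \<epsilon>" and C0: "0 \<le> C" and h: "0 \<le> h" "h \<le> 1"
    and x: "supported a b x" "l2norm a b x \<le> R" and sg: "supported a b (grad x)"
  shows "energy a b (descent a b h x)
      \<le> energy a b x - h * ((l2norm a b (grad x))\<^sup>2 / (1 + (l2norm a b (grad x))\<^sup>2))
        + h * (\<epsilon> * R + (C + 2) * h)"
proof -
  define g where "g = l2norm a b (grad x)"
  define k where "k = h / (1 + g\<^sup>2)"
  define u where "u = (\<lambda>t. (- k) *\<^sub>R grad x t)"
  have "0 < 1 + g\<^sup>2" by (simp add: add_pos_nonneg)
  then have k: "0 \<le> k" using h by (simp add: k_def)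
  have nu: "l2norm a b u = k * g"
    unfolding u_def l2norm_scaleR using k by (simp add: g_def)
  have kg: "k * g \<le> h"
    using descent_length[OF h(1), of a b x] by (simp add: k_def g_def)
  have kg0: "0 \<le> k * g" using k by (simp add: g_def)
  have "energy a b (\<lambda>t. x t + u t) \<le> energy a b x + (\<Sum>t\<in>{a..b}. grad x t \<bullet> u t)
           + \<epsilon> * l2norm a b x * l2norm a b u + (C + 2) * (l2norm a b u)\<^sup>2"
  proof (rule energy_first_order[OF C \<epsilon> x])
    show "supported a b u" using sg by (auto simp: u_def supported_def)
    show "l2norm a b u \<le> 1" using kg h nu by simp
  qed
  also have "(\<Sum>t\<in>{a..b}. grad x t \<bullet> u t) = - k * g\<^sup>2"
    by (simp add: u_def g_def l2norm_power2 power2_norm_eq_inner sum_distrib_left sum_negf)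
  also have "\<epsilon> * l2norm a b x * l2norm a b u \<le> \<epsilon> * R * h"
  proof -
    have "0 \<le> R" using order_trans[OF l2norm_nonneg x(2)] .
    then show ?thesis
      unfolding nu using \<epsilon> x(2) h kg kg0 by (intro mult_mono) simp_all
  qed
  also have "(C + 2) * (l2norm a b u)\<^sup>2 \<le> (C + 2) * h\<^sup>2"
    unfolding nu using C0 kg kg0 by (intro mult_left_mono power_mono) simp_all
  finally have *: "energy a b (\<lambda>t. x t + u t)
      \<le> energy a b x + - k * g\<^sup>2 + \<epsilon> * R * h + (C + 2) * h\<^sup>2" by simp
  have decrease: "k * g\<^sup>2 = h * (g\<^sup>2 / (1 + g\<^sup>2))" by (simp add: k_def)
  have increase: "h * (\<epsilon> * R + (C + 2) * h) = \<epsilon> * R * h + (C + 2) * h\<^sup>2"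
    by (simp only: distrib_left power2_eq_square mult_ac)
  have step: "descent a b h x = (\<lambda>t. x t + u t)"
    by (simp add: descent_def u_def k_def g_def)
  show ?thesis
    unfolding step g_def[symmetric] using * decrease increase by linarith
qed

text \<open>
All entries of such a sequence lie in the well. On the sphere of radius \<open>r\<close> this is the barrier
that every deformation of a path from the origin to a point of negative energy has to cross.
\<close>

lemma energy_well:
  assumes "supported a b x" "l2norm a b x \<le> r"
  shows "c * (l2norm a b x)\<^sup>2 \<le> energy a b x"
proof -
  have "c * (l2norm a b x)\<^sup>2 = (\<Sum>t\<in>{a..b}. c * (norm (x t))\<^sup>2)"
    by (simp add: l2norm_power2 sum_distrib_left)
  also have "\<dots> \<le> energy a b x"
    unfolding energy_def
  proof (rule sum_mono)
    fix t
    have "c * (norm (x t))\<^sup>2 \<le> F t (x t)"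
      using norm_le_l2norm[OF assms(1), of t] assms(2) by (intro F_well) auto
    then show "c * (norm (x t))\<^sup>2 \<le> (norm (x t - x (t - 1)))\<^sup>2 / 2 + F t (x t)"
      by (simp add: add_increasing)
  qed
  finally show ?thesis .
qed

section \<open>Almost critical sequences\<close>

lemma continuous_on_descent:
  assumes "\<And>t. continuous_on S (\<lambda>s. X s t)"
  shows "continuous_on S (\<lambda>s. descent a b h (X s) t)"
proof -
  have g: "continuous_on S (\<lambda>s. grad (X s) t)" for t
    unfolding grad_def
    by (intro continuous_intros assms continuous_on_compose2[OF f_cont assms]) auto
  have "1 + (l2norm a b (grad (X s)))\<^sup>2 \<noteq> 0" for s
    by (rule less_imp_neq[symmetric]) (simp add: add_pos_nonneg)
  then show ?thesis
    unfolding descent_def l2norm_def L2_set_def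
    by (intro continuous_intros assms g) (auto simp: l2norm_def L2_set_def)
qed

lemma continuous_on_l2norm:
  assumes "\<And>t. continuous_on S (\<lambda>s. X s t)"
  shows "continuous_on S (\<lambda>s. l2norm a b (X s))"
  unfolding l2norm_def L2_set_def by (intro continuous_intros assms)

lemma descent_zero [simp]: "descent a b h (\<lambda>t. 0) = (\<lambda>t. 0)"
  by (simp add: descent_def grad_def)

text \<open>
The kinetic energy of a spike is \<open>(norm v)\<^sup>2\<close>: it consists of two jumps of height \<open>norm v\<close>, each
weighted by one half.
\<close>

lemma energy_single:
  assumes "a < t0" "t0 < b"
  shows "energy a b (\<lambda>t. if t = t0 then v else 0) = (norm v)\<^sup>2 + F t0 v"
proof -
  let ?x = "\<lambda>t. if t = t0 then v else 0"
  have sx: "supported a b ?x" using assms by (auto simp: supported_def)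
  have "(\<Sum>t\<in>{a..b}. (norm (?x t - ?x (t - 1)))\<^sup>2) = (\<Sum>t\<in>{a..b}. (2 *\<^sub>R ?x t - ?x (t - 1) - ?x (t + 1)) \<bullet> ?x t)"
    unfolding power2_norm_eq_inner by (rule sum_by_parts[OF sx])
  also have "\<dots> = (\<Sum>t\<in>{a..b}. if t = t0 then 2 * (norm v)\<^sup>2 else 0)"
    by (intro sum.cong) (auto simp: power2_norm_eq_inner)
  also have "\<dots> = 2 * (norm v)\<^sup>2" using assms by simp
  finally have 1: "(\<Sum>t\<in>{a..b}. (norm (?x t - ?x (t - 1)))\<^sup>2) = 2 * (norm v)\<^sup>2" .
  have "(\<Sum>t\<in>{a..b}. F t (?x t)) = (\<Sum>t\<in>{a..b}. if t = t0 then F t0 v else 0)"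
    by (intro sum.cong) auto
  also have "\<dots> = F t0 v" using assms by simp
  finally show ?thesis
    using 1 by (simp add: energy_def sum.distrib sum_divide_distrib[symmetric])
qed

text \<open>
A mountain pass argument without a minimax value. Deform the whole segment of spikes \<open>s *\<^sub>R e\<close>,
\<open>0 \<le> s \<le> 1\<close>, by \<open>m\<close> descent steps of size \<open>h\<close>. The end \<open>s = 0\<close> stays at the origin, and the end
\<open>s = 1\<close> keeps negative energy and hence stays beyond the sphere of radius \<open>r\<close>, on
and inside of which the energy is nonnegative. By continuity in \<open>s\<close> some trajectory ends exactly on
the sphere, where the energy is at least \<open>\<rho>\<close>. This trajectory has lost a bounded amount of energy
during a long time \<open>S = m * h\<close>, so its gradient must have been small at some moment. All sequences met
are finitely supported, as every step enlarges the support by one site on each side.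
\<close>

lemma palais_smale:
  shows "\<exists>\<rho>>0. \<exists>E. \<forall>\<sigma>>0. \<exists>a b z. supported a b z \<and> supported a b (grad z)
      \<and> \<rho> \<le> energy a b z \<and> energy a b z \<le> E \<and> l2norm a b (grad z) \<le> \<sigma>"
proof -
  obtain t0 e where e: "F t0 e + (norm e)\<^sup>2 < 0" using valley by blast
  define \<rho> where "\<rho> = c * r\<^sup>2"
  have \<rho>: "0 < \<rho>" using c_pos r_pos by (simp add: \<rho>_def)
  have "compact ((\<lambda>s. (norm (s *\<^sub>R e))\<^sup>2 + F t0 (s *\<^sub>R e)) ` {0..1::real})"
    by (intro compact_continuous_image continuous_intros continuous_on_compose2[OF F_cont]) auto
  then obtain E0 where E0: "0 < E0"
      "\<And>s. s \<in> {0..1::real} \<Longrightarrow> \<bar>(norm (s *\<^sub>R e))\<^sup>2 + F t0 (s *\<^sub>R e)\<bar> \<le> E0"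
    by (auto simp: bounded_pos dest!: compact_imp_bounded)
  have "\<exists>a b z. supported a b z \<and> supported a b (grad z)
      \<and> \<rho> / 2 \<le> energy a b z \<and> energy a b z \<le> E0 + 1 \<and> l2norm a b (grad z) \<le> \<sigma>"
    if \<sigma>: "0 < \<sigma>" for \<sigma>
  proof -
    define \<gamma> where "\<gamma> = \<sigma>\<^sup>2 / (1 + \<sigma>\<^sup>2)"
    have \<gamma>: "0 < \<gamma>" using \<sigma> by (simp add: \<gamma>_def add_pos_nonneg)
    \<comment> \<open>if every gradient along the way were longer than \<open>\<sigma>\<close>, time \<open>S\<close> would use up all the energy\<close>
    define S where "S = (E0 + 1) / \<gamma>"
    have S: "0 < S" "S * \<gamma> = E0 + 1" using \<gamma> E0 by (simp_all add: S_def)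
    \<comment> \<open>\<open>d\<close> is the total discretisation error that can be afforded over the time \<open>S\<close>\<close>
    define d where "d = min 1 (min (\<rho> / 2) (- (F t0 e + (norm e)\<^sup>2) / 2))"
    have d: "0 < d" "d \<le> 1" "d \<le> \<rho> / 2" "F t0 e + (norm e)\<^sup>2 + d < 0"
      using \<rho> e by (auto simp: d_def min_def field_simps)
    \<comment> \<open>no trajectory leaves the ball of radius \<open>R\<close> within time \<open>S\<close>\<close>
    define R where "R = norm e + S"
    have R: "0 < R" using S by (simp add: R_def add_nonneg_pos)
    define \<epsilon> where "\<epsilon> = d / S / (2 * R)"
    have \<epsilon>: "0 < \<epsilon>" "\<epsilon> * R = d / S / 2" using d S R by (simp_all add: \<epsilon>_def)
    obtain C where "0 \<le> C" and C: "\<And>t v u. norm v \<le> R \<Longrightarrow> norm u \<le> 1 \<Longrightarrow>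
          F t (v + u) \<le> F t v + f t v \<bullet> u + \<epsilon> * norm v * norm u + C * (norm u)\<^sup>2"
      using first_order[OF R \<epsilon>(1)] by blast
    \<comment> \<open>\<open>C\<close> depends on \<open>S\<close> and \<open>R\<close> but not on the number of steps, so the step size can be chosen last\<close>
    obtain m :: nat where m: "max S ((C + 2) * S / (d / S / 2)) < real m"
      using reals_Archimedean2 by blast
    have Sm: "S < real m" and Cm: "(C + 2) * S / (d / S / 2) < real m" using m by simp_all
    have m0: "0 < real m" using S Sm by linarith
    define h where "h = S / real m"
    have h: "0 < h" "h \<le> 1" "real m * h = S" using Sm m0 S by (simp_all add: h_def)
    have "(C + 2) * h \<le> d / S / 2"
    proof -
      have "(C + 2) * S / (d / S / 2) \<le> real m" using Cm by simp
      then have "(C + 2) * S \<le> real m * (d / S / 2)"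
        using d S by (simp only: pos_divide_le_eq divide_pos_pos zero_less_numeral)
      then show ?thesis
        using m0 by (simp only: h_def times_divide_eq_right pos_divide_le_eq) (simp add: mult.commute)
    qed
    then have err: "h * (\<epsilon> * R + (C + 2) * h) \<le> h * (d / S)"
      using h \<epsilon> by (intro mult_left_mono) auto
    have hd: "real m * (h * (d / S)) = d"
      using S unfolding mult.assoc[symmetric] h(3) by simp
    \<comment> \<open>the last gradient that is used, after \<open>m - 1\<close> steps, still has its support strictly inside this window\<close>
    define a where "a = t0 - int m - 1"
    define b where "b = t0 + int m + 1"
    define X where "X s j = (descent a b h ^^ j) (\<lambda>t. if t = t0 then s *\<^sub>R e else 0)" for s :: real and j
    have X0: "X s 0 = (\<lambda>t. if t = t0 then s *\<^sub>R e else 0)" for s by (simp add: X_def)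
    have XS: "X s (Suc j) = descent a b h (X s j)" for s j by (simp add: X_def)
    have supp': "supported (t0 - int j - 1) (t0 + int j + 1) (X s j)" for s j
    proof (induction j)
      case 0
      then show ?case by (auto simp: X0 supported_def)
    next
      case (Suc j)
      then show ?case using supported_descent[OF Suc] by (simp add: XS algebra_simps)
    qed
    have supp: "supported a b (X s j)" if "j \<le> m" for s j
      using that by (intro supported_mono[OF supp']) (auto simp: a_def b_def)
    have suppg: "supported a b (grad (X s j))" if "j < m" for s j
      using that by (intro supported_mono[OF supported_grad[OF supp']]) (auto simp: a_def b_def)
    have len0: "l2norm a b (X s 0) \<le> norm e" if "s \<in> {0..1}" for s
    proof -
      have "(l2norm a b (X s 0))\<^sup>2 = (\<Sum>t\<in>{a..b}. if t = t0 then (norm (s *\<^sub>R e))\<^sup>2 else 0)"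
        unfolding l2norm_power2 X0 by (intro sum.cong) auto
      also have "\<dots> = (s * norm e)\<^sup>2" using that by (simp add: a_def b_def power_mult_distrib)
      also have "\<dots> \<le> (norm e)\<^sup>2"
        using that by (intro power_mono mult_left_le_one_le) auto
      finally show ?thesis by (simp add: power2_le_iff_abs_le)
    qed
    have len: "l2norm a b (X s j) \<le> norm e + real j * h" if "s \<in> {0..1}" for s j
    proof (induction j)
      case 0
      then show ?case using len0[OF that] by simp
    next
      case (Suc j)
      then show ?case
        using l2norm_descent[of h a b "X s j"] h by (simp add: XS algebra_simps)
    qed
    have lenR: "l2norm a b (X s j) \<le> R" if "s \<in> {0..1}" "j \<le> m" for s j
    proof -
      have "real j * h \<le> real m * h" using that h by (intro mult_right_mono) auto
      then show ?thesis using len[OF that(1), of j] h by (simp add: R_def)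
    qed
    have E0': "energy a b (X s 0) \<le> E0" if "s \<in> {0..1}" for s
      using E0(2)[OF that] unfolding X0 by (subst energy_single) (auto simp: a_def b_def)
    define \<phi> where "\<phi> s j = (l2norm a b (grad (X s j)))\<^sup>2 / (1 + (l2norm a b (grad (X s j)))\<^sup>2)" for s j
    have \<phi>0: "0 \<le> \<phi> s j" for s j by (simp add: \<phi>_def)
    have \<phi>\<gamma>: "\<gamma> \<le> \<phi> s j" if "\<sigma> < l2norm a b (grad (X s j))" for s j
    proof -
      have "\<sigma>\<^sup>2 \<le> (l2norm a b (grad (X s j)))\<^sup>2" using that \<sigma> by (intro power_mono) auto
      moreover have "p / (1 + p) \<le> q / (1 + q)" if "0 \<le> p" "p \<le> q" for p q :: real
        using that by (simp add: divide_simps algebra_simps)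
      ultimately show ?thesis by (simp add: \<gamma>_def \<phi>_def)
    qed
    have one_step: "energy a b (X s (Suc j)) \<le> energy a b (X s j) - h * \<phi> s j + h * (d / S)"
      if "s \<in> {0..1}" "j < m" for s j
    proof -
      have "energy a b (X s (Suc j)) \<le> energy a b (X s j) - h * \<phi> s j + h * (\<epsilon> * R + (C + 2) * h)"
        unfolding XS \<phi>_def
        using that h \<epsilon> \<open>0 \<le> C\<close> supp suppg lenR by (intro energy_descent[OF C]) auto
      then show ?thesis using err by simp
    qed
    have slack: "energy a b (X s j) \<le> energy a b (X s i) + real (j - i) * (h * (d / S))"
      if "s \<in> {0..1}" "i \<le> j" "j \<le> m" for s i j
      using that(2,3)
    proof (induction j rule: dec_induct)
      case base
      then show ?case by simp
    next
      case (step j)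
      have "0 \<le> h * \<phi> s j" using h \<phi>0 by simp
      moreover have "real (Suc j - i) * (h * (d / S)) = real (j - i) * (h * (d / S)) + h * (d / S)"
        using step by (simp add: Suc_diff_le distrib_right add_divide_distrib)
      moreover have "energy a b (X s j) \<le> energy a b (X s i) + real (j - i) * (h * (d / S))"
        using step by simp
      ultimately show ?case
        using step(4) one_step[OF that(1), of j] by linarith
    qed
    have slack_d: "energy a b (X s j) \<le> energy a b (X s i) + d"
      if "s \<in> {0..1}" "i \<le> j" "j \<le> m" for s i j
    proof -
      have "real (j - i) * (h * (d / S)) \<le> real m * (h * (d / S))"
        using that h d S by (intro mult_right_mono) auto
      then show ?thesis using slack[OF that] hd by simp
    qed
    have cont: "continuous_on {0..1} (\<lambda>s. X s j t)" for j t
    proof (induction j arbitrary: t)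
      case 0
      then show ?case by (cases "t = t0") (auto simp: X0 intro!: continuous_intros)
    next
      case (Suc j)
      show ?case unfolding XS by (intro continuous_on_descent Suc)
    qed
    have start: "l2norm a b (X 0 m) \<le> r"
    proof -
      have "X 0 j = (\<lambda>t. 0)" for j
        by (induction j) (auto simp: X0 XS)
      then show ?thesis using r_pos by (simp add: l2norm_def L2_set_def)
    qed
    have finish: "r \<le> l2norm a b (X 1 m)"
    proof (rule ccontr)
      assume "\<not> r \<le> l2norm a b (X 1 m)"
      then have "c * (l2norm a b (X 1 m))\<^sup>2 \<le> energy a b (X 1 m)"
        by (intro energy_well supp) auto
      then have "0 \<le> energy a b (X 1 m)"
        using order_trans[OF mult_nonneg_nonneg[OF less_imp_le[OF c_pos] zero_le_power2]] by blast
      moreover have "energy a b (X 1 m) \<le> energy a b (X 1 0) + d"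
        by (rule slack_d) auto
      moreover have "energy a b (X 1 0) = (norm e)\<^sup>2 + F t0 e"
        unfolding X0 by (subst energy_single) (auto simp: a_def b_def)
      ultimately show False using d by simp
    qed
    \<comment> \<open>the intermediate value theorem replaces the topological linking argument\<close>
    obtain s where s: "0 \<le> s" "s \<le> 1" "l2norm a b (X s m) = r"
      using IVT'[of "\<lambda>s. l2norm a b (X s m)" 0 r 1] start finish continuous_on_l2norm[OF cont]
      by auto
    then have s01: "s \<in> {0..1}" by simp
    have top: "\<rho> \<le> energy a b (X s m)"
      using energy_well[of a b "X s m"] supp s by (simp add: \<rho>_def)
    have "\<exists>j<m. l2norm a b (grad (X s j)) \<le> \<sigma>"
    proof (rule ccontr)
      assume "\<not> ?thesis"
      then have big: "\<gamma> \<le> \<phi> s j" if "j < m" for j using \<phi>\<gamma> that by force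
      have "energy a b (X s j) \<le> E0 + real j * (h * (d / S) - h * \<gamma>)" if "j \<le> m" for j
        using that
      proof (induction j)
        case 0
        then show ?case using E0'[OF s01] by simp
      next
        case (Suc j)
        have "h * \<gamma> \<le> h * \<phi> s j" using big[of j] Suc h by (intro mult_left_mono) auto
        moreover have "real (Suc j) * (h * (d / S) - h * \<gamma>)
            = real j * (h * (d / S) - h * \<gamma>) + (h * (d / S) - h * \<gamma>)"
          by (simp add: distrib_right)
        ultimately show ?case using Suc one_step[OF s01, of j] by simp
      qed
      then have "energy a b (X s m) \<le> E0 + real m * (h * (d / S) - h * \<gamma>)" by simp
      also have "\<dots> = E0 + d - S * \<gamma>" 
        unfolding right_diff_distrib hd unfolding mult.assoc[symmetric] h(3) by simp
      also have "\<dots> \<le> 0" using S d by simp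
      finally show False using top \<rho> by simp
    qed
    then obtain j where j: "j < m" "l2norm a b (grad (X s j)) \<le> \<sigma>" by blast
    have "energy a b (X s j) \<le> energy a b (X s 0) + d" "energy a b (X s m) \<le> energy a b (X s j) + d"
      using j s01 by (auto intro!: slack_d)
    then show ?thesis
      using j supp suppg top E0'[OF s01] d
      by (intro exI[of _ a] exI[of _ b] exI[of _ "X s j"]) auto
  qed
  then show ?thesis using \<rho> by (intro exI[of _ "\<rho> / 2"]) auto
qed

section \<open>Bounds and passage to the limit\<close>

text \<open>
The usual Ambrosetti-Rabinowitz computation: in \<open>\<beta> * energy a b z\<close> minus the pairing of \<open>grad z\<close> with \<open>z\<close>
the kinetic terms keep the factor \<open>\<beta> / 2 - 1 > 0\<close> and the on-site terms dominate \<open>\<kappa> * (norm (z t))\<^sup>2\<close>.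
\<close>

lemma energy_bounds_l2norm:
  assumes z: "supported a b z" and E: "energy a b z \<le> E" and g: "l2norm a b (grad z) \<le> 1"
  shows "(l2norm a b z)\<^sup>2 \<le> (2 * \<beta> * E + 1 / \<kappa>) / \<kappa>"
proof -
  have "\<kappa> * (l2norm a b z)\<^sup>2 = (\<Sum>t\<in>{a..b}. \<kappa> * (norm (z t))\<^sup>2)"
    by (simp add: l2norm_power2 sum_distrib_left)
  also have "\<dots> \<le> (\<Sum>t\<in>{a..b}. (\<beta> * F t (z t) - f t (z t) \<bullet> z t)
        + (\<beta> / 2 - 1) * (norm (z t - z (t - 1)))\<^sup>2)"
    using superquadratic \<beta>_gt by (intro sum_mono add_increasing2 mult_nonneg_nonneg) auto
  also have "\<dots> = \<beta> * energy a b z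
      - ((\<Sum>t\<in>{a..b}. (norm (z t - z (t - 1)))\<^sup>2) + (\<Sum>t\<in>{a..b}. f t (z t) \<bullet> z t))"
    by (simp add: energy_def sum_distrib_left sum.distrib[symmetric] sum_subtractf[symmetric] algebra_simps)
  also have "(\<Sum>t\<in>{a..b}. (norm (z t - z (t - 1)))\<^sup>2) + (\<Sum>t\<in>{a..b}. f t (z t) \<bullet> z t)
      = (\<Sum>t\<in>{a..b}. grad z t \<bullet> z t)"
    unfolding power2_norm_eq_inner sum_by_parts[OF z]
    by (simp add: grad_def sum.distrib inner_add_left)
  also have "\<beta> * energy a b z - (\<Sum>t\<in>{a..b}. grad z t \<bullet> z t) \<le> \<beta> * E + l2norm a b z"
  proof -
    have "\<bar>\<Sum>t\<in>{a..b}. grad z t \<bullet> z t\<bar> \<le> l2norm a b (grad z) * l2norm a b z"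
      by (rule l2norm_inner_ineq)
    also have "\<dots> \<le> 1 * l2norm a b z" using g by (intro mult_right_mono) auto
    finally have "\<bar>\<Sum>t\<in>{a..b}. grad z t \<bullet> z t\<bar> \<le> l2norm a b z" by simp
    moreover have "\<beta> * energy a b z \<le> \<beta> * E" using E \<beta>_gt by (intro mult_left_mono) auto
    ultimately show ?thesis by linarith
  qed
  also have "l2norm a b z \<le> \<kappa> * (l2norm a b z)\<^sup>2 / 2 + 1 / (2 * \<kappa>)"
  proof -
    have "0 \<le> (\<kappa> * l2norm a b z - 1)\<^sup>2 / (2 * \<kappa>)" using \<kappa>_pos by simp
    also have "\<dots> = \<kappa> * (l2norm a b z)\<^sup>2 / 2 + 1 / (2 * \<kappa>) - l2norm a b z"
      using \<kappa>_pos by (simp add: power2_eq_square field_simps)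
    finally show ?thesis by simp
  qed
  finally have "\<kappa> * (l2norm a b z)\<^sup>2 \<le> 2 * \<beta> * E + 1 / \<kappa>" by (simp add: field_simps)
  then show ?thesis using \<kappa>_pos by (simp add: pos_le_divide_eq mult.commute)
qed

text \<open>
Excludes vanishing. Inside the well the pairing of \<open>grad z\<close> with \<open>z\<close> controls the \<open>\<ell>\<^sup>2\<close> norm, hence
also the energy; an almost critical sequence of energy at least \<open>\<rho>\<close> therefore has a site where it
leaves the well.
\<close>

lemma energy_small_if_everywhere_small:
  assumes C: "\<And>t u. norm u \<le> r \<Longrightarrow> F t u \<le> C * (norm u)\<^sup>2" and "0 \<le> C"
    and z: "supported a b z" and small: "\<And>t. norm (z t) \<le> r"
  shows "energy a b z \<le> (C + 2) / c * (l2norm a b (grad z) * l2norm a b z)"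
proof -
  have "c * (l2norm a b z)\<^sup>2 \<le> (\<Sum>t\<in>{a..b}. f t (z t) \<bullet> z t)"
    unfolding l2norm_power2 sum_distrib_left using small f_well by (intro sum_mono) auto
  also have "\<dots> \<le> (\<Sum>t\<in>{a..b}. f t (z t) \<bullet> z t) + (\<Sum>t\<in>{a..b}. (norm (z t - z (t - 1)))\<^sup>2)"
    by (simp add: sum_nonneg)
  also have "\<dots> = (\<Sum>t\<in>{a..b}. grad z t \<bullet> z t)"
    unfolding power2_norm_eq_inner sum_by_parts[OF z]
    by (simp add: grad_def sum.distrib inner_add_left)
  also have "\<dots> \<le> l2norm a b (grad z) * l2norm a b z"
    using l2norm_inner_ineq[of "grad z" z a b] by simp
  finally have N: "(l2norm a b z)\<^sup>2 \<le> (l2norm a b (grad z) * l2norm a b z) / c"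
    using c_pos by (simp add: pos_le_divide_eq mult.commute)
  have "energy a b z = (\<Sum>t\<in>{a..b}. (norm (z t - z (t - 1)))\<^sup>2) / 2 + (\<Sum>t\<in>{a..b}. F t (z t))"
    by (simp add: energy_def sum.distrib sum_divide_distrib)
  also have "\<dots> \<le> 4 * (l2norm a b z)\<^sup>2 / 2 + C * (l2norm a b z)\<^sup>2"
  proof (intro add_mono divide_right_mono)
    show "(\<Sum>t\<in>{a..b}. F t (z t)) \<le> C * (l2norm a b z)\<^sup>2"
      unfolding l2norm_power2 sum_distrib_left using small C by (intro sum_mono) auto
  qed (use sum_diff_le[OF z] in auto)
  also have "\<dots> = (C + 2) * (l2norm a b z)\<^sup>2" by (simp add: algebra_simps)
  also have "\<dots> \<le> (C + 2) * ((l2norm a b (grad z) * l2norm a b z) / c)"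
    using N \<open>0 \<le> C\<close> by (intro mult_left_mono) auto
  finally show ?thesis by simp
qed

text \<open>
The site where an almost critical sequence leaves the well may be anywhere, but translating by a multiple
of the period brings it into \<open>{0..<T}\<close> without changing the gradient. This restores the compactness that
is lost on the unbounded lattice.
\<close>

lemma concentrated_almost_critical:
  shows "\<exists>M. \<forall>\<sigma>>0. \<exists>z. (\<forall>t. norm (grad z t) \<le> \<sigma>)
      \<and> (\<forall>A. finite A \<longrightarrow> (\<Sum>t\<in>A. (norm (z t))\<^sup>2) \<le> M) \<and> r\<^sup>2 \<le> (\<Sum>t\<in>{0..<T}. (norm (z t))\<^sup>2)"
proof -
  obtain \<rho> E where "0 < \<rho>" and PS: "\<And>\<sigma>. 0 < \<sigma> \<Longrightarrow> \<exists>a b z. supported a b z \<and> supported a b (grad z)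
      \<and> \<rho> \<le> energy a b z \<and> energy a b z \<le> E \<and> l2norm a b (grad z) \<le> \<sigma>"
    using palais_smale by metis
  define M where "M = (2 * \<beta> * E + 1 / \<kappa>) / \<kappa>"
  obtain C where C0: "0 \<le> C" and C: "\<And>t v u. norm v \<le> 1 \<Longrightarrow> norm u \<le> 1 \<Longrightarrow>
          F t (v + u) \<le> F t v + f t v \<bullet> u + 1 * norm v * norm u + C * (norm u)\<^sup>2"
    using first_order[of 1 1] by auto
  have C': "F t u \<le> C * (norm u)\<^sup>2" if "norm u \<le> r" for t u
    using C[of 0 u t] that r_le_1 by simp
  have "\<exists>z. (\<forall>t. norm (grad z t) \<le> \<sigma>)
      \<and> (\<forall>A. finite A \<longrightarrow> (\<Sum>t\<in>A. (norm (z t))\<^sup>2) \<le> M) \<and> r\<^sup>2 \<le> (\<Sum>t\<in>{0..<T}. (norm (z t))\<^sup>2)"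
    if "0 < \<sigma>" for \<sigma>
  proof -
    \<comment> \<open>small enough for a sequence inside the well to have energy at most \<open>\<rho> / 2\<close>; \<open>\<bar>M\<bar> + 1\<close> bounds its norm\<close>
    define \<tau> where "\<tau> = min \<sigma> (min 1 (\<rho> * c / (2 * (C + 2) * (\<bar>M\<bar> + 1))))"
    have "0 < \<tau>" using \<open>0 < \<sigma>\<close> \<open>0 < \<rho>\<close> c_pos C0 by (auto simp: \<tau>_def intro!: divide_pos_pos mult_pos_pos)
    then obtain a b z where z: "supported a b z" "supported a b (grad z)"
      "\<rho> \<le> energy a b z" "energy a b z \<le> E" and g: "l2norm a b (grad z) \<le> \<tau>"
      using PS by blast
    have zM: "(l2norm a b z)\<^sup>2 \<le> M"
      unfolding M_def using z g by (intro energy_bounds_l2norm) (auto simp: \<tau>_def)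
    have "\<exists>t. r < norm (z t)"
    proof (rule ccontr)
      assume "\<not> ?thesis"
      then have "energy a b z \<le> (C + 2) / c * (l2norm a b (grad z) * l2norm a b z)"
        using C' C0 z by (intro energy_small_if_everywhere_small) (auto simp: not_less)
      also have "\<dots> \<le> (C + 2) / c * (\<tau> * (\<bar>M\<bar> + 1))"
      proof -
        have "2 * l2norm a b z \<le> 1 + (l2norm a b z)\<^sup>2"
          using sum_squares_bound[of "l2norm a b z" 1] by simp
        then have "l2norm a b z \<le> \<bar>M\<bar> + 1" using zM by linarith
        then show ?thesis using g C0 c_pos \<open>0 < \<tau>\<close> by (intro mult_left_mono mult_mono) auto
      qed
      also have "\<dots> \<le> (C + 2) / c * (\<rho> * c / (2 * (C + 2) * (\<bar>M\<bar> + 1)) * (\<bar>M\<bar> + 1))"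
        using C0 c_pos by (intro mult_left_mono mult_right_mono) (auto simp: \<tau>_def)
      also have "\<dots> = \<rho> / 2"
        using C0 c_pos by (simp add: divide_simps)
      finally show False using z \<open>0 < \<rho>\<close> by simp
    qed
    then obtain t where t: "r < norm (z t)" by blast
    define k where "k = t div T"
    define w where "w = (\<lambda>s. z (s + k * T))"
    have "grad w s = grad z (s + k * T)" for s
      unfolding grad_def w_def periodic_add_multiple[of f, OF f_periodic] by (simp add: algebra_simps)
    then have 1: "norm (grad w s) \<le> \<sigma>" for s
      using norm_le_l2norm[OF z(2), of "s + k * T"] g by (simp add: \<tau>_def)
    have 2: "(\<Sum>s\<in>A. (norm (w s))\<^sup>2) \<le> M" if "finite A" for A
    proof -
      have "(\<Sum>s\<in>A. (norm (w s))\<^sup>2) = (\<Sum>s\<in>(\<lambda>s. s + k * T) ` A. (norm (z s))\<^sup>2)"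
        by (subst sum.reindex) (auto simp: w_def)
      also have "\<dots> \<le> M"
        using sum_norm_le_l2norm[OF z(1), of "(\<lambda>s. s + k * T) ` A"] that zM by simp
      finally show ?thesis .
    qed
    have "t mod T \<in> {0..<T}" using T_pos by simp
    moreover have "w (t mod T) = z t" by (simp add: w_def k_def)
    ultimately have "(norm (z t))\<^sup>2 \<le> (\<Sum>t\<in>{0..<T}. (norm (w t))\<^sup>2)"
      using member_le_sum[of "t mod T" "{0..<T}" "\<lambda>t. (norm (w t))\<^sup>2"] by simp
    moreover have "r\<^sup>2 \<le> (norm (z t))\<^sup>2" using t r_pos by (intro power_mono) auto
    ultimately show ?thesis using 1 2 by (intro exI[of _ w]) auto
  qed
  then show ?thesis by blast
qed

text \<open>
The equation at a site involves only three neighbouring entries, so it passes to pointwise limits, and so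
do the uniform square sum bound, which gives the decay at infinity, and the lower bound over one period,
which makes the limit nonzero.
\<close>

lemma homoclinic_exists:
  "\<exists>x. (\<forall>t. grad x t = 0) \<and> (\<exists>t. x t \<noteq> 0) \<and> (x \<longlongrightarrow> 0) at_top \<and> (x \<longlongrightarrow> 0) at_bot"
proof -
  define P where "P M \<sigma> z \<longleftrightarrow> (\<forall>t. norm (grad z t) \<le> \<sigma>)
      \<and> (\<forall>A. finite A \<longrightarrow> (\<Sum>t\<in>A. (norm (z t))\<^sup>2) \<le> M) \<and> r\<^sup>2 \<le> (\<Sum>t\<in>{0..<T}. (norm (z t))\<^sup>2)"
    for M \<sigma> z
  obtain M where M: "\<And>\<sigma>. 0 < \<sigma> \<Longrightarrow> \<exists>z. P M \<sigma> z"
    using concentrated_almost_critical unfolding P_def by blast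
  have "\<forall>n. \<exists>z. P M (inverse (real (Suc n))) z"
    using M by simp
  then obtain z where "\<And>n. P M (inverse (real (Suc n))) (z n)"
    by metis
  then have g: "\<And>n t. norm (grad (z n) t) \<le> inverse (real (Suc n))"
    and M: "\<And>n A. finite A \<Longrightarrow> (\<Sum>t\<in>A. (norm (z n t))\<^sup>2) \<le> M"
    and r: "\<And>n. r\<^sup>2 \<le> (\<Sum>t\<in>{0..<T}. (norm (z n t))\<^sup>2)"
    unfolding P_def by blast+
  have bound: "norm (z n t) \<le> sqrt M" for n t
    using M[of "{t}" n] by (simp add: real_le_rsqrt)
  obtain k where k: "strict_mono (k :: nat \<Rightarrow> nat)" "\<And>t. \<exists>l. (\<lambda>n. z (k n) t) \<longlonglongrightarrow> l"
  proof (rule function_convergent_subsequence[of "UNIV :: int set" z "sqrt M"])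
    show "countable (UNIV :: int set)" by simp
    show "norm (z n t) \<le> sqrt M" for n t by (rule bound)
  next
    fix k :: "nat \<Rightarrow> nat"
    assume "strict_mono k" and lim: "\<And>t. t \<in> UNIV \<Longrightarrow> \<exists>l. (\<lambda>n. z (k n) t) \<longlonglongrightarrow> l"
    have "\<exists>l. (\<lambda>n. z (k n) t) \<longlonglongrightarrow> l" for t by (rule lim) simp
    with \<open>strict_mono k\<close> show thesis by (rule that)
  qed
  define x where "x t = lim (\<lambda>n. z (k n) t)" for t
  have x: "(\<lambda>n. z (k n) t) \<longlonglongrightarrow> x t" for t
    using k(2)[of t] unfolding x_def convergent_def[symmetric] convergent_LIMSEQ_iff .
  have "grad x t = 0" for t
  proof -
    have "(\<lambda>n. grad (z (k n)) t) \<longlonglongrightarrow> grad x t"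
      unfolding grad_def
      by (intro tendsto_intros x continuous_on_tendsto_compose[OF f_cont x]) auto
    moreover have "(\<lambda>n. grad (z (k n)) t) \<longlonglongrightarrow> 0"
    proof (rule Lim_null_comparison)
      show "\<forall>\<^sub>F n in sequentially. norm (grad (z (k n)) t) \<le> inverse (real (Suc (k n)))"
        using g by simp
      show "(\<lambda>n. inverse (real (Suc (k n)))) \<longlonglongrightarrow> 0"
        using LIMSEQ_subseq_LIMSEQ[OF LIMSEQ_inverse_real_of_nat k(1)] by (simp add: o_def)
    qed
    ultimately show ?thesis by (rule LIMSEQ_unique)
  qed
  moreover have sums: "(\<lambda>n. \<Sum>t\<in>A. (norm (z (k n) t))\<^sup>2) \<longlonglongrightarrow> (\<Sum>t\<in>A. (norm (x t))\<^sup>2)" for A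
    by (intro tendsto_intros x)
  have "\<exists>t. x t \<noteq> 0"
  proof (rule ccontr)
    assume "\<not> ?thesis"
    moreover have "r\<^sup>2 \<le> (\<Sum>t\<in>{0..<T}. (norm (x t))\<^sup>2)"
      using r by (intro LIMSEQ_le_const[OF sums]) auto
    ultimately show False using r_pos by simp
  qed
  moreover have "(\<Sum>t\<in>A. (norm (x t))\<^sup>2) \<le> M" if "finite A" for A
    using M[OF that] by (intro LIMSEQ_le_const2[OF sums]) auto
  ultimately show ?thesis
    using tendsto_zero_if_square_summable[of x M] by blast
qed

end

section \<open>Homoclinic orbits of the difference equation\<close>

theorem corollary3p1:
  fixes L :: "int \<Rightarrow> real ^ 'n ^ 'n"
    and V :: "int \<Rightarrow> real ^ 'n \<Rightarrow> real"
    and V' :: "int \<Rightarrow> real ^ 'n \<Rightarrow> real ^ 'n"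
  assumes C1: "\<And>t. C1_with_gradient (V t) (V' t)"
    and V'0: "\<And>t. V' t 0 = 0"
    and A1: "\<exists>T::int. T > 0 \<and> (\<forall>t. L (t + T) = L t \<and> V (t + T) = V t)"
    and A2: "\<And>t. transpose (L t) = L t \<and> pos_def_matrix (L t)"
    and A3: "\<And>t. V t 0 = 0 \<and> (\<lambda>x. norm (V' t x)) \<in> o[at 0](\<lambda>x. norm x)"
    and A4: "\<exists>\<beta> \<alpha> :: real. \<beta> > 2 \<and> 0 < \<alpha> \<and> \<alpha> < \<beta> / 2 - 1 \<and>
               (\<forall>t x. \<beta> * V t x - V' t x \<bullet> x \<le> \<alpha> * (x \<bullet> (L t *v x)))"
    and A5: "\<exists>t0 x0. x0 \<noteq> 0 \<and> V t0 x0 - (1 / 2) * (x0 \<bullet> (L t0 *v x0)) > 0"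
  shows "\<exists>x. nontrivial_homoclinic L V' x"
proof -
  obtain T where T: "0 < T" and LT: "\<And>t. L (t + T) = L t" and VT: "\<And>t. V (t + T) = V t"
    using A1 by blast
  obtain \<beta> \<alpha> where \<beta>: "2 < \<beta>" and \<alpha>: "\<alpha> < \<beta> / 2 - 1"
    and AR: "\<And>t x. \<beta> * V t x - V' t x \<bullet> x \<le> \<alpha> * (x \<bullet> (L t *v x))"
    using A4 by blast
  have gradV: "GDERIV (V t) x :> V' t x" and contV': "continuous_on UNIV (V' t)" for t x
    using C1[of t] by (auto simp: C1_with_gradient_def)
  have V'T: "V' (t + T) = V' t" for t
    using GDERIV_unique gradV[of "t + T"] gradV[of t] unfolding VT by blast
  have symL: "transpose (L t) = L t" and posL: "pos_def_matrix (L t)" for t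
    using A2 by auto
  have V0: "V t 0 = 0" for t using A3 by blast
  have V'_small: "\<forall>\<^sub>F \<delta> in at_right 0. \<forall>t x. norm x \<le> \<delta> \<longrightarrow> norm (V' t x) \<le> \<epsilon> * norm x"
    if "0 < \<epsilon>" for \<epsilon>
    by (rule eventually_all_periodic[OF _ T]) (use A3 V'0 V'T that in \<open>auto intro: small_o_imp_le\<close>)
  have "\<forall>\<^sub>F l in at_right 0. \<forall>t x. l * (norm x)\<^sup>2 \<le> x \<bullet> (L t *v x)"
    by (rule eventually_all_periodic[OF _ T]) (use LT posL in \<open>auto intro: pos_def_matrix_coercive\<close>)
  then obtain l where l: "0 < l" "\<And>t x. l * (norm x)\<^sup>2 \<le> x \<bullet> (L t *v x)"
    unfolding eventually_at_right_field by (metis dense)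
  have "\<forall>\<^sub>F K in at_top. \<forall>t x. x \<bullet> (L t *v x) \<le> K * (norm x)\<^sup>2"
    by (rule eventually_all_periodic[OF _ T]) (use LT in \<open>auto intro: quadratic_form_bound\<close>)
  then obtain K where K: "0 \<le> K" "\<And>t x. x \<bullet> (L t *v x) \<le> K * (norm x)\<^sup>2"
    unfolding eventually_at_top_linorder by (metis linear)
  have "\<forall>\<^sub>F \<delta> in at_right 0. \<forall>t x. norm x \<le> \<delta> \<longrightarrow> norm (V' t x) \<le> l / 4 * norm x"
    by (rule V'_small) (use l in simp)
  then obtain \<delta> where \<delta>: "0 < \<delta>" "\<And>t x. norm x \<le> \<delta> \<Longrightarrow> norm (V' t x) \<le> l / 4 * norm x"
    unfolding eventually_at_right_field by (metis dense)
  \<comment> \<open>the bound \<open>1\<close> makes every displacement within the well admissible in \<open>first_order\<close>\<close>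
  define r where "r = min \<delta> 1"
  have r: "0 < r" "r \<le> 1" and r_small: "\<And>t x. norm x \<le> r \<Longrightarrow> norm (V' t x) \<le> l / 4 * norm x"
    using \<delta> by (auto simp: r_def)

  define F where "F t x = (1 / 2) * (x \<bullet> (L t *v x)) - V t x" for t x
  define f where "f t x = L t *v x - V' t x" for t x
  have gradF: "GDERIV (F t) x :> f t x" for t x
    unfolding F_def f_def by (intro GDERIV_diff GDERIV_quadratic_form symL gradV)
  \<comment> \<open>the quadratic part of \<open>F\<close> contributes \<open>(\<beta> / 2 - 1) * (x \<bullet> (L t *v x))\<close>, of which \<open>A4\<close> takes away only a part\<close>
  have ARF: "(\<beta> / 2 - 1 - \<alpha>) * (x \<bullet> (L t *v x)) \<le> \<beta> * F t x - f t x \<bullet> x" for t x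
  proof -
    have "\<beta> * F t x - f t x \<bullet> x = (\<beta> / 2 - 1) * (x \<bullet> (L t *v x)) - (\<beta> * V t x - V' t x \<bullet> x)"
      by (simp add: F_def f_def inner_diff_left inner_commute algebra_simps)
    then show ?thesis using AR[of t x] by (simp add: algebra_simps)
  qed

  \<comment> \<open>in the well, \<open>V\<close> costs at most \<open>l / 4\<close> of the \<open>l / 2\<close> that the quadratic part provides\<close>
  interpret periodic_lattice F f T r "l / 4" \<beta> "(\<beta> / 2 - 1 - \<alpha>) * l"
  proof
    fix t
    show "continuous_on UNIV (F t)"
      using gradF by (intro continuous_at_imp_continuous_on ballI) (auto simp: gderiv_def intro: has_derivative_continuous)
    show "continuous_on UNIV (f t)"
      unfolding f_def by (intro continuous_intros contV' linear_continuous_on matrix_vector_mul_bounded_linear)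
    show "F t 0 = 0" by (simp add: F_def V0)
    show "f t 0 = 0" by (simp add: f_def V'0)
    show "f (t + T) = f t" by (simp add: f_def LT V'T fun_eq_iff)
    fix v
    show "(\<beta> / 2 - 1 - \<alpha>) * l * (norm v)\<^sup>2 \<le> \<beta> * F t v - f t v \<bullet> v"
    proof -
      have "(\<beta> / 2 - 1 - \<alpha>) * (l * (norm v)\<^sup>2) \<le> (\<beta> / 2 - 1 - \<alpha>) * (v \<bullet> (L t *v v))"
        using l \<alpha> by (intro mult_left_mono) auto
      then show ?thesis using ARF[of v t] by (simp add: mult.assoc)
    qed
    assume v: "norm v \<le> r"
    have V'v: "V' t w \<bullet> v \<le> l / 4 * (norm v)\<^sup>2" if "norm w \<le> norm v" for w
    proof -
      have "V' t w \<bullet> v \<le> norm (V' t w) * norm v" by (rule norm_cauchy_schwarz)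
      also have "\<dots> \<le> l / 4 * norm v * norm v"
        using r_small[of w t] that v l by (intro mult_right_mono order_trans[OF r_small] mult_left_mono) auto
      finally show ?thesis by (simp add: power2_eq_square)
    qed
    obtain \<theta> where \<theta>: "0 < \<theta>" "\<theta> < 1" "V t (0 + v) - V t 0 = V' t (0 + \<theta> *\<^sub>R v) \<bullet> v"
      by (rule gradient_mean_value[where f = "V t" and g = "V' t" and x = 0 and u = v, OF gradV]) (rule that)
    have "V t v \<le> l / 4 * (norm v)\<^sup>2"
      using V'v[of "\<theta> *\<^sub>R v"] \<theta> by (simp add: V0 mult_left_le_one_le)
    then show "l / 4 * (norm v)\<^sup>2 \<le> F t v"
      using l(2)[of v t] by (simp add: F_def)
    show "l / 4 * (norm v)\<^sup>2 \<le> f t v \<bullet> v"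
      using l(2)[of v t] V'v[of v] mult_nonneg_nonneg[OF less_imp_le[OF l(1)] zero_le_power2[of "norm v"]]
      by (simp add: f_def inner_diff_left inner_commute[of v])
  next
    fix R \<epsilon> :: real assume R: "0 < R" and \<epsilon>: "0 < \<epsilon>"
    have "\<forall>\<^sub>F \<delta> in at_right 0. \<forall>t x. norm x \<le> \<delta> \<longrightarrow> norm (V' t x) \<le> \<epsilon> / 2 * norm x"
      by (rule V'_small) (use \<epsilon> in simp)
    then obtain \<delta> where \<delta>: "0 < \<delta>" "\<And>t x. norm x \<le> \<delta> \<Longrightarrow> norm (V' t x) \<le> \<epsilon> / 2 * norm x"
      unfolding eventually_at_right_field by (metis dense)
    have "\<forall>\<^sub>F C in at_top. \<forall>t. \<forall>x y. norm x \<le> R + 1 \<longrightarrow> norm y \<le> R + 1 \<longrightarrow>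
           norm (V' t y - V' t x) \<le> \<epsilon> * norm x + C * norm (y - x)"
    proof (rule eventually_all_periodic[OF _ T])
      show "\<forall>\<^sub>F C in at_top. \<forall>x y. norm x \<le> R + 1 \<longrightarrow> norm y \<le> R + 1 \<longrightarrow>
           norm (V' t y - V' t x) \<le> \<epsilon> * norm x + C * norm (y - x)" for t
        by (rule almost_small_modulus[OF contV' _ \<epsilon> \<delta>]) (use R in simp)
    qed (simp add: V'T)
    then obtain C where C: "0 \<le> C" "\<And>t x y. norm x \<le> R + 1 \<Longrightarrow> norm y \<le> R + 1 \<Longrightarrow>
           norm (V' t y - V' t x) \<le> \<epsilon> * norm x + C * norm (y - x)"
      unfolding eventually_at_top_linorder by (metis linear)
    have "F t (v + u) \<le> F t v + f t v \<bullet> u + \<epsilon> * norm v * norm u + (C + K) * (norm u)\<^sup>2"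
      if v: "norm v \<le> R" and u: "norm u \<le> 1" for t v u
    proof -
      obtain \<theta> where \<theta>: "0 < \<theta>" "\<theta> < 1" "V t (v + u) - V t v = V' t (v + \<theta> *\<^sub>R u) \<bullet> u"
        by (rule gradient_mean_value[where f = "V t" and g = "V' t" and x = v and u = u, OF gradV]) (rule that)
      have \<theta>u: "norm (\<theta> *\<^sub>R u) \<le> norm u" using \<theta> by (simp add: mult_left_le_one_le)
      have "V' t v \<bullet> u - V' t (v + \<theta> *\<^sub>R u) \<bullet> u = - ((V' t (v + \<theta> *\<^sub>R u) - V' t v) \<bullet> u)"
        by (simp add: inner_diff_left)
      also have "\<dots> \<le> norm (V' t (v + \<theta> *\<^sub>R u) - V' t v) * norm u"
        using Cauchy_Schwarz_ineq2[of "V' t (v + \<theta> *\<^sub>R u) - V' t v" u] by linarith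
      also have "\<dots> \<le> (\<epsilon> * norm v + C * norm u) * norm u"
      proof (intro mult_right_mono)
        have "norm (v + \<theta> *\<^sub>R u) \<le> R + 1"
          using norm_triangle_ineq[of v "\<theta> *\<^sub>R u"] v u \<theta>u by linarith
        then have "norm (V' t (v + \<theta> *\<^sub>R u) - V' t v) \<le> \<epsilon> * norm v + C * norm (\<theta> *\<^sub>R u)"
          using C(2)[of v "v + \<theta> *\<^sub>R u" t] v by simp
        also have "\<dots> \<le> \<epsilon> * norm v + C * norm u"
          using \<theta>u C(1) by (intro add_left_mono mult_left_mono)
        finally show "norm (V' t (v + \<theta> *\<^sub>R u) - V' t v) \<le> \<epsilon> * norm v + C * norm u" .
      qed simp
      finally have Vu: "V t v + V' t v \<bullet> u - V t (v + u) \<le> \<epsilon> * norm v * norm u + C * (norm u)\<^sup>2"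
        using \<theta>(3) by (simp add: power2_eq_square distrib_right)
      have "(v + u) \<bullet> (L t *v (v + u)) = v \<bullet> (L t *v v) + 2 * ((L t *v v) \<bullet> u) + u \<bullet> (L t *v u)"
        using symmetric_inner_commute[OF symL, of v t u]
        by (simp add: matrix_vector_right_distrib inner_add_left inner_add_right inner_commute)
      moreover have "u \<bullet> (L t *v u) \<le> 2 * (K * (norm u)\<^sup>2)"
        using K(2)[of u t] K(1) mult_nonneg_nonneg[OF K(1) zero_le_power2[of "norm u"]] by linarith
      ultimately show ?thesis
        using Vu unfolding F_def f_def inner_diff_left distrib_right by linarith
    qed
    then show "\<exists>C\<ge>0. \<forall>t v u. norm v \<le> R \<longrightarrow> norm u \<le> 1 \<longrightarrow>
          F t (v + u) \<le> F t v + f t v \<bullet> u + \<epsilon> * norm v * norm u + C * (norm u)\<^sup>2"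
      using C K by (intro exI[of _ "C + K"]) auto
  next
    obtain t0 x0 where x0: "F t0 x0 < 0" using A5 by (auto simp: F_def)
    have "f t0 y \<bullet> y \<le> \<beta> * F t0 y" for y
    proof -
      have "0 \<le> y \<bullet> (L t0 *v y)"
        using l(2)[of y t0] l(1) by (meson mult_nonneg_nonneg less_imp_le zero_le_power2 order_trans)
      then have "0 \<le> (\<beta> / 2 - 1 - \<alpha>) * (y \<bullet> (L t0 *v y))"
        using \<alpha> by simp
      then show ?thesis using ARF[of y t0] by linarith
    qed
    then show "\<exists>t e. F t e + (norm e)\<^sup>2 < 0"
      using superhomogeneous_beats_quadratic[OF gradF _ \<beta> x0] by blast
  qed (use T r l \<alpha> \<beta> in auto)

  obtain x where "\<And>t. grad x t = 0" "\<exists>t. x t \<noteq> 0" "(x \<longlongrightarrow> 0) at_top" "(x \<longlongrightarrow> 0) at_bot"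
    using homoclinic_exists by blast
  moreover from this have "fdiff (fdiff x) (t - 1) - L t *v x t + V' t (x t) = 0" for t
    using \<open>grad x t = 0\<close> by (simp add: grad_def fdiff_def f_def scaleR_2 algebra_simps)
  ultimately show ?thesis
    by (auto simp: nontrivial_homoclinic_def is_solution_def)
qed

end
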